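(* Let $d\ge1$ and $\alpha\in(0,2)$. There exists a constant $c=c(d,\alpha)>0$ such that for every real-valued $f\in\mathscr{S}(\mathbb{R}^d)$, not identically zero, and every $x\in\mathbb{R}^d$, $$\nabla f(x)\cdot\Lambda^\alpha\nabla f(x)\ \ge\ \frac12\,\Lambda^\alpha\big(|\nabla f|^2\big)(x)+\frac{|\nabla f(x)|^{2+\alpha}}{c\,\|f\|_{L^\infty}^\alpha}.$$
   Context: $\mathscr{S}(\mathbb{R}^d)$ is the Schwartz class. $\Lambda=(-\Delta)^{1/2}$, and $\Lambda^\alpha$ is the Fourier multiplier $(\Lambda^\alpha g)^{\wedge}(\xi)=|\xi|^\alpha\hat g(\xi)$, acting componentwise on vector-valued functions; for $0<\alpha<2$ it equals $\Lambda^\alpha g(x)=c_{d,\alpha}\,\mathrm{P.V.}\int_{\mathbb{R}^d}\frac{g(x)-g(x-y)}{|y|^{d+\alpha}}\,dy$ with a normalizing constant $c_{d,\alpha}>0$. *)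

theory Defs
  imports "HOL-Analysis.Analysis" "HOL-Probability.Essential_Supremum"
begin

definition partial :: "'n \<Rightarrow> (real ^ 'n \<Rightarrow> 'b::real_normed_vector) \<Rightarrow> real ^ 'n::finite \<Rightarrow> 'b"
  where "partial i f x = frechet_derivative f (at x) (axis i 1)"

primrec iter_partial ::
    "'n list \<Rightarrow> (real ^ 'n \<Rightarrow> 'b::real_normed_vector) \<Rightarrow> real ^ 'n::finite \<Rightarrow> 'b"
  where
    "iter_partial [] f = f"
  | "iter_partial (i # is) f = partial i (iter_partial is f)"

text \<open>Total differentiability of all iterated partial derivatives is \<open>C\<^sup>\<infinity>\<close> smoothness. It has
  to be required explicitly: \<^const>\<open>frechet_derivative\<close> is an arbitrary value where the
  derivative does not exist.\<close>

definition schwartz :: "(real ^ 'n::finite \<Rightarrow> 'b::real_normed_vector) set"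
  where "schwartz = {f. \<forall>is.
           (\<forall>x. iter_partial is f differentiable (at x)) \<and>
           (\<forall>k::nat. bounded (range (\<lambda>x. norm x ^ k *\<^sub>R iter_partial is f x)))}"

definition gradient :: "(real ^ 'n \<Rightarrow> real) \<Rightarrow> real ^ 'n::finite \<Rightarrow> real ^ 'n"
  where "gradient f x = (\<chi> i. partial i f x)"

lemma GDERIV_gradient:
  fixes f :: "real ^ 'n::finite \<Rightarrow> real"
  assumes "f differentiable (at x)"
  shows "GDERIV f x :> gradient f x"
proof -
  let ?D = "frechet_derivative f (at x)"
  have D: "(f has_derivative ?D) (at x)"
    using assms by (simp add: frechet_derivative_works)
  interpret bounded_linear ?D by (rule has_derivative_bounded_linear[OF D])
  have "?D h = h \<bullet> gradient f x" for h
  proof -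
    have "?D h = ?D (\<Sum>i\<in>UNIV. h $ i *\<^sub>R axis i 1)"
      using basis_expansion[of h] by (simp add: scalar_mult_eq_scaleR)
    also have "\<dots> = h \<bullet> gradient f x"
      by (simp add: sum scale inner_vec_def gradient_def partial_def)
    finally show ?thesis .
  qed
  then have "?D = (\<lambda>h. h \<bullet> gradient f x)" by auto
  with D show ?thesis by (simp add: gderiv_def)
qed

text \<open>The convention \<open>\<integral> g(x) exp(-i x\<cdot>\<xi>) dx\<close> is the one for which \<open>-\<Delta>\<close> has symbol \<open>|\<xi>|\<^sup>2\<close>, so
  that the square root \<open>\<Lambda>\<close> of \<open>-\<Delta>\<close> has symbol \<open>|\<xi>|\<close>.\<close>

definition fourier :: "(real ^ 'n \<Rightarrow> complex) \<Rightarrow> real ^ 'n::finite \<Rightarrow> complex"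
  where "fourier g \<xi> = (LINT x|lborel. cis (- (x \<bullet> \<xi>)) * g x)"

definition inverse_fourier :: "(real ^ 'n \<Rightarrow> complex) \<Rightarrow> real ^ 'n::finite \<Rightarrow> complex"
  where "inverse_fourier h x =
           (LINT \<xi>|lborel. cis (x \<bullet> \<xi>) * h \<xi>) / complex_of_real ((2 * pi) ^ CARD('n))"

definition Lambda_complex :: "real \<Rightarrow> (real ^ 'n \<Rightarrow> complex) \<Rightarrow> real ^ 'n::finite \<Rightarrow> complex"
  where "Lambda_complex \<alpha> g =
           inverse_fourier (\<lambda>\<xi>. complex_of_real (norm \<xi> powr \<alpha>) * fourier g \<xi>)"

text \<open>On real-valued functions the multiplier produces real values, so that taking the real part
  loses nothing (see \<open>Lambda_complex_of_real\<close>).\<close>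

definition Lambda :: "real \<Rightarrow> (real ^ 'n \<Rightarrow> real) \<Rightarrow> real ^ 'n::finite \<Rightarrow> real"
  where "Lambda \<alpha> g x = Re (Lambda_complex \<alpha> (\<lambda>y. complex_of_real (g y)) x)"

lemma lborel_integral_reflect:
  fixes F :: "'a::euclidean_space \<Rightarrow> 'b::{banach, second_countable_topology}"
  shows "(LINT x|lborel. F (- x)) = (LINT x|lborel. F x)"
proof -
  have d: "distr lborel borel uminus = (lborel :: 'a measure)"
    by (subst (2) lborel_affine[of "-1" 0]) (simp_all add: density_1 one_ennreal_def[symmetric])
  show ?thesis
  proof (cases "integrable lborel F")
    case True
    have "(LINT x|lborel. F x) = (LINT x|distr lborel borel uminus. F x)" by (simp add: d)
    also have "\<dots> = (LINT x|lborel. F (- x))"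
      using True by (intro integral_distr) auto
    finally show ?thesis by simp
  next
    case False
    have "\<not> integrable lborel (\<lambda>x. F (- x))"
    proof
      assume i: "integrable lborel (\<lambda>x. F (- x))"
      then have "(\<lambda>x. F (- x)) \<in> borel_measurable borel" by auto
      then have "(\<lambda>x. F (- (- x))) \<in> borel_measurable borel"
        by (rule measurable_compose[rotated]) auto
      with i have "integrable (distr lborel borel uminus) F"
        by (subst integrable_distr_eq) auto
      with False show False by (simp add: d)
    qed
    with False show ?thesis by (simp add: not_integrable_integral_eq)
  qed
qed

lemma Lambda_complex_of_real:
  "Lambda_complex \<alpha> (\<lambda>y. complex_of_real (g y)) x = complex_of_real (Lambda \<alpha> g x)"
proof -
  let ?G = "\<lambda>y. complex_of_real (g y)"
  have F: "cnj (fourier ?G \<xi>) = fourier ?G (- \<xi>)" for \<xi>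
    unfolding fourier_def Bochner_Integration.integral_cnj[symmetric] by (simp del: Bochner_Integration.integral_cnj add: cis_cnj)
  let ?H = "\<lambda>\<xi>. cis (x \<bullet> \<xi>) * (complex_of_real (norm \<xi> powr \<alpha>) * fourier ?G \<xi>)"
  have "cnj (LINT \<xi>|lborel. ?H \<xi>) = (LINT \<xi>|lborel. ?H (- \<xi>))"
    unfolding Bochner_Integration.integral_cnj[symmetric] by (simp del: Bochner_Integration.integral_cnj add: cis_cnj F)
  also have "\<dots> = (LINT \<xi>|lborel. ?H \<xi>)" by (rule lborel_integral_reflect)
  finally have "cnj (Lambda_complex \<alpha> ?G x) = Lambda_complex \<alpha> ?G x"
    unfolding Lambda_complex_def inverse_fourier_def by simp
  then show ?thesis
    unfolding Lambda_def by (metis Reals_cnj_iff of_real_Re)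
qed

definition Lambda_vec :: "real \<Rightarrow> (real ^ 'n \<Rightarrow> real ^ 'm) \<Rightarrow> real ^ 'n::finite \<Rightarrow> real ^ 'm"
  where "Lambda_vec \<alpha> G x = (\<chi> i. Lambda \<alpha> (\<lambda>y. G y $ i) x)"

text \<open>The value is meaningful only for essentially bounded measurable \<open>f\<close>, as
  \<^const>\<open>real_of_ereal\<close> sends \<open>\<infinity>\<close> to \<open>0\<close>; Schwartz functions are of this kind.\<close>

definition Linf_norm :: "(real ^ 'n::finite \<Rightarrow> real) \<Rightarrow> real"
  where "Linf_norm f = real_of_ereal (esssup lborel (\<lambda>x. ereal \<bar>f x\<bar>))"

end

theory Submission
  imports Defs "HOL-Probability.Probability"
begin

text \<open>Write \<open>P\<^sub>s g(x)\<close> for the mean of \<open>g(x + s z)\<close> over a standard Gaussian vector \<open>z\<close>. Its symbol is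
  \<open>exp (- s\<^sup>2 |\<xi>|\<^sup>2 / 2)\<close>, and \<open>|\<xi>|\<^sup>\<alpha>\<close> is, up to a positive factor \<open>K\<close>, the integral of
  \<open>1 - exp (- s\<^sup>2 |\<xi>|\<^sup>2 / 2)\<close> against \<open>s\<^sup>-\<^sup>1\<^sup>-\<^sup>\<alpha> ds\<close> over \<open>s > 0\<close>. Hence \<open>K \<Lambda>\<^sup>\<alpha> g(x)\<close> is the integral of
  \<open>g(x) - P\<^sub>s g(x)\<close> against the same weight (\<open>has_bochner_integral_Lambda\<close>). This rests on Fubini's
  theorem, the decay of the Fourier transform of a Schwartz function and Fourier inversion, and
  the latter is itself obtained from the Gaussian means as \<open>s\<close> tends to \<open>0\<close>.

  Let \<open>v = \<nabla>f(x)\<close>. The formula, applied to the components of \<open>\<nabla>f\<close> and to \<open>|\<nabla>f|\<^sup>2\<close> (again a Schwartz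
  function, \<open>schwartz_norm_gradient_squared\<close>), turns
  \<open>v \<bullet> \<Lambda>\<^sup>\<alpha>\<nabla>f(x) - \<Lambda>\<^sup>\<alpha>(|\<nabla>f|\<^sup>2)(x) / 2\<close> into \<open>1 / (2 K)\<close> times the weighted integral of
  \<open>B(s)\<close>, the Gaussian mean of \<open>|v - \<nabla>f(x + s z)|\<^sup>2\<close>. Clearly \<open>B(s) \<ge> 0\<close>, and expanding the square
  gives \<open>B(s) \<ge> |v|\<^sup>2 - 2 v \<bullet> P\<^sub>s \<nabla>f(x)\<close>. Integration by parts moves the derivative to the Gaussian,
  so that \<open>v \<bullet> P\<^sub>s \<nabla>f(x)\<close> is at most \<open>M |v| \<parallel>f\<parallel> / s\<close>, where \<open>\<parallel>f\<parallel>\<close> is the supremum norm and \<open>M\<close> depends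
  only on the dimension (\<open>gauss_mean_directional_derivative_le\<close>). Thus \<open>B(s) \<ge> |v|\<^sup>2 / 2\<close> for
  \<open>s \<ge> 4 M \<parallel>f\<parallel> / |v|\<close>, and integrating \<open>s\<^sup>-\<^sup>1\<^sup>-\<^sup>\<alpha>\<close> over this range yields the power
  \<open>|v|\<^sup>2\<^sup>+\<^sup>\<alpha> / \<parallel>f\<parallel>\<^sup>\<alpha>\<close>. If \<open>v = 0\<close>, this power vanishes and \<open>B(s) \<ge> 0\<close> suffices.\<close>

section \<open>Lebesgue integration on Euclidean space\<close>

lemma has_bochner_integral_prod_components:
  fixes f :: "'n::finite \<Rightarrow> real \<Rightarrow> 'b::{real_normed_field,banach,second_countable_topology}"
  assumes f: "\<And>i. integrable lborel (f i)"
  shows "has_bochner_integral lborel (\<lambda>x::real^'n. \<Prod>i\<in>UNIV. f i (x $ i))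
           (\<Prod>i\<in>UNIV. integral\<^sup>L lborel (f i))"
proof -
  interpret product_sigma_finite "\<lambda>_::real^'n. lborel :: real measure"
    by standard
  have Basis: "(Basis :: (real^'n) set) = (\<lambda>i. axis i 1) ` UNIV"
    by (auto simp: Basis_vec_def)
  have inj: "inj (\<lambda>i::'n. axis i (1::real))"
    by (simp add: inj_on_def axis_eq_axis)
  have prod_Basis: "(\<Prod>b\<in>(Basis :: (real^'n) set). h b) = (\<Prod>i\<in>UNIV. h (axis i 1))"
    for h :: "real^'n \<Rightarrow> 'b"
    by (simp add: Basis prod.reindex[OF inj])
  let ?T = "\<lambda>y. \<Sum>b\<in>(Basis :: (real^'n) set). y b *\<^sub>R b"
  let ?P = "\<Pi>\<^sub>M b\<in>(Basis :: (real^'n) set). (lborel :: real measure)"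
  let ?g = "\<lambda>x::real^'n. \<Prod>i\<in>UNIV. f i (x $ i)"
  have [measurable]: "\<And>i. f i \<in> borel_measurable borel"
    using borel_measurable_integrable[OF f] by simp
  have T: "?T \<in> ?P \<rightarrow>\<^sub>M borel" by measurable
  have g: "?g \<in> borel_measurable borel" by measurable
  have gT: "?g (?T y) = (\<Prod>b\<in>(Basis :: (real^'n) set). f (axis_index b) (y b))" for y
  proof -
    have "?T y $ i = y (axis i 1)" for i
    proof -
      have "?T y $ i = ?T y \<bullet> axis i 1" by (simp add: cart_eq_inner_axis)
      also have "\<dots> = y (axis i 1)" by (simp add: inner_sum_left_Basis)
      finally show ?thesis .
    qed
    then show ?thesis by (simp add: prod_Basis)
  qed
  have "has_bochner_integral ?P (\<lambda>y. ?g (?T y)) (\<Prod>b\<in>(Basis :: (real^'n) set). integral\<^sup>L lborel (f (axis_index b)))"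
    unfolding gT has_bochner_integral_iff
    by (intro conjI product_integrable_prod product_integral_prod f) auto
  then have "has_bochner_integral (distr ?P borel ?T) ?g (\<Prod>i\<in>UNIV. integral\<^sup>L lborel (f i))"
    by (simp add: has_bochner_integral_distr[OF g T] prod_Basis)
  then show ?thesis by (simp add: lborel_eq[symmetric])
qed

lemma
  fixes f :: "'a::euclidean_space \<Rightarrow> 'b::{banach,second_countable_topology}"
  assumes f: "integrable lborel f"
  shows integrable_lborel_translate: "integrable lborel (\<lambda>x. f (x + a))"
    and integral_lborel_translate: "(LINT x|lborel. f (x + a)) = (LINT x|lborel. f x)"
proof -
  have fd: "integrable (distr lborel borel ((+) a)) f"
    using f by (simp add: lborel_distr_plus)
  show "integrable lborel (\<lambda>x. f (x + a))"
    using integrable_distr[OF _ fd] by (simp add: add.commute)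
  have "(LINT x|lborel. f x) = (LINT x|distr lborel borel ((+) a). f x)"
    by (simp add: lborel_distr_plus)
  also have "\<dots> = (LINT x|lborel. f (a + x))"
    using f by (intro integral_distr) auto
  finally show "(LINT x|lborel. f (x + a)) = (LINT x|lborel. f x)"
    by (simp add: add.commute)
qed

lemma integrable_lborel_affine:
  fixes f :: "'a::euclidean_space \<Rightarrow> 'b::{banach,second_countable_topology}"
  assumes f: "integrable lborel f" and c: "c > 0"
  shows "integrable lborel (\<lambda>x. f (t + c *\<^sub>R x))"
proof -
  have [measurable]: "f \<in> borel_measurable borel" using f by simp
  have "integrable (density (distr lborel borel (\<lambda>x. t + c *\<^sub>R x)) (\<lambda>_. \<bar>c\<bar> ^ DIM('a))) f"
    using f c lborel_affine[of c t] by simp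
  then have "integrable lborel (\<lambda>x. \<bar>c\<bar> ^ DIM('a) *\<^sub>R f (t + c *\<^sub>R x))"
    by (subst (asm) integrable_density) (auto simp: integrable_distr_eq)
  then have "integrable lborel (\<lambda>x. inverse (\<bar>c\<bar> ^ DIM('a)) *\<^sub>R \<bar>c\<bar> ^ DIM('a) *\<^sub>R f (t + c *\<^sub>R x))"
    by (rule integrable_scaleR_right)
  then show ?thesis using c by simp
qed

lemma integral_lborel_affine:
  fixes f :: "'a::euclidean_space \<Rightarrow> 'b::{banach,second_countable_topology}"
  assumes f[measurable]: "f \<in> borel_measurable borel" and c: "c > 0"
  shows "(LINT x|lborel. f x) = c ^ DIM('a) *\<^sub>R (LINT x|lborel. f (t + c *\<^sub>R x))"
  using c by (subst lborel_affine[of c t]) (auto simp: integral_density integral_distr)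

text \<open>The integration by parts used below: writing \<open>F(y + v) - F(y)\<close> as the integral of the
  derivative along the segment, the integral over \<open>y\<close> of the left-hand side vanishes by
  translation invariance.\<close>

lemma integral_directional_derivative_eq_0:
  fixes F :: "'a::euclidean_space \<Rightarrow> 'b::euclidean_space"
  assumes F: "\<And>y. (F has_derivative F' y) (at y)"
    and cont: "continuous_on UNIV (\<lambda>y. F' y v)"
    and int: "integrable lborel F" and int': "integrable lborel (\<lambda>y. F' y v)"
  shows "(LINT y|lborel. F' y v) = 0"
proof -
  let ?D = "\<lambda>y. F' y v"
  have [measurable]: "?D \<in> borel_measurable borel"
    using int' by auto
  have seg: "(LINT s|lborel. indicator {0..1} s *\<^sub>R ?D (y + s *\<^sub>R v)) = F (y + v) - F y" for y
  proof -
    have "(LINT s|lborel. indicator {0..1} s *\<^sub>R ?D (y + s *\<^sub>R v))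
        = F (y + (1::real) *\<^sub>R v) - F (y + (0::real) *\<^sub>R v)"
    proof (rule integral_FTC_atLeastAtMost)
      fix s :: real
      interpret bounded_linear "F' (y + s *\<^sub>R v)"
        using F by (rule has_derivative_bounded_linear)
      have "(F \<circ> (\<lambda>s. y + s *\<^sub>R v) has_derivative F' (y + s *\<^sub>R v) \<circ> (\<lambda>h. h *\<^sub>R v)) (at s)"
        by (rule diff_chain_at) (auto intro!: derivative_eq_intros F)
      then have "((\<lambda>s. F (y + s *\<^sub>R v)) has_vector_derivative ?D (y + s *\<^sub>R v)) (at s)"
        by (simp add: has_vector_derivative_def comp_def scale)
      then show "((\<lambda>s. F (y + s *\<^sub>R v)) has_vector_derivative ?D (y + s *\<^sub>R v)) (at s within {0..1})"
        by (rule has_vector_derivative_at_within)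
    next
      show "continuous_on {0..1} (\<lambda>s. ?D (y + s *\<^sub>R v))"
        by (rule continuous_on_compose2[OF cont]) (auto intro!: continuous_intros)
    qed simp
    then show ?thesis by simp
  qed
  let ?f = "\<lambda>(s::real, y). indicator {0..1} s *\<^sub>R ?D (y + s *\<^sub>R v)"
  have norm_f: "(LINT y|lborel. norm (?f (s, y))) = indicator {0..1} s *\<^sub>R (LINT y|lborel. norm (?D y))" for s
    using integral_lborel_translate[OF integrable_norm[OF int'], of "s *\<^sub>R v"] by simp
  have f: "integrable (lborel \<Otimes>\<^sub>M lborel) ?f"
  proof (rule lborel_pair.Fubini_integrable)
    show "?f \<in> borel_measurable (lborel \<Otimes>\<^sub>M lborel)" by measurable
    show "integrable lborel (\<lambda>s. LINT y|lborel. norm (?f (s, y)))"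
      unfolding norm_f by (intro integrable_scaleR_left) simp
    show "AE s in lborel. integrable lborel (\<lambda>y. ?f (s, y))"
      using integrable_lborel_translate[OF int'] by simp
  qed
  have "(LINT y|lborel. F (y + v) - F y) = (LINT y|lborel. LINT s|lborel. ?f (s, y))"
    by (simp add: seg)
  also have "\<dots> = (LINT s|lborel. LINT y|lborel. ?f (s, y))"
    by (rule lborel_pair.Fubini_integral) (use f in \<open>simp add: case_prod_beta\<close>)
  also have "\<dots> = (LINT s|lborel. indicator {0..1::real} s *\<^sub>R (LINT y|lborel. ?D y))"
    using integral_lborel_translate[OF int'] by simp
  also have "\<dots> = (LINT y|lborel. ?D y)"
    by simp
  also have "(LINT y|lborel. F (y + v) - F y) = 0"
    using integrable_lborel_translate[OF int] int
    by (simp add: integral_lborel_translate[OF int])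
  finally show ?thesis by simp
qed

lemma integrable_inverse_1_plus_square_lborel:
  "integrable lborel (\<lambda>x::real. inverse (1 + x\<^sup>2))"
  using integrable_inverse_1_plus_square by (simp add: set_integrable_def)

text \<open>The comparison function is the product of the functions \<open>1 / (1 + x\<^sub>i\<^sup>2)\<close>, which is at least
  \<open>1 / (1 + |x|\<^sup>2)\<^sup>n\<close>.\<close>

lemma integrable_of_decay:
  fixes h :: "real^'n::finite \<Rightarrow> 'b::{banach,second_countable_topology}"
  assumes [measurable]: "h \<in> borel_measurable borel"
    and B: "\<And>x. norm (h x) \<le> B" and C: "\<And>x. norm x ^ (2 * CARD('n)) * norm (h x) \<le> C"
  shows "integrable lborel h"
proof -
  let ?n = "CARD('n)"
  define W where "W x = (\<Prod>i\<in>UNIV. inverse (1 + (x $ i)\<^sup>2))" for x :: "real^'n"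
  have W: "integrable lborel W"
    unfolding W_def[abs_def]
    using has_bochner_integral_prod_components[of "\<lambda>_ x. inverse (1 + x\<^sup>2)"]
      integrable_inverse_1_plus_square_lborel by (auto simp: has_bochner_integral_iff)
  have "norm (h x) \<le> (2 ^ ?n * (B + C)) * W x" for x
  proof -
    have pos: "0 < (\<Prod>i\<in>UNIV. (1 + (x $ i)\<^sup>2))"
      by (intro prod_pos) (auto intro: add_pos_nonneg)
    have "(\<Prod>i\<in>UNIV. (1 + (x $ i)\<^sup>2)) \<le> (\<Prod>i\<in>(UNIV::'n set). 1 + (norm x)\<^sup>2)"
    proof (intro prod_mono conjI)
      fix i :: 'n
      show "1 + (x $ i)\<^sup>2 \<le> 1 + (norm x)\<^sup>2"
        using power_mono[OF component_le_norm_cart[of x i], of 2] by simp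
    qed auto
    also have "\<dots> = (1 + (norm x)\<^sup>2) ^ ?n" by simp
    also have "\<dots> \<le> 2 ^ ?n * (1 + (norm x) ^ (2 * ?n))"
    proof -
      have "(1 + (norm x)\<^sup>2) ^ ?n \<le> (2 * max 1 ((norm x)\<^sup>2)) ^ ?n"
        by (intro power_mono) auto
      also have "\<dots> = 2 ^ ?n * max 1 ((norm x)\<^sup>2) ^ ?n" by (simp add: power_mult_distrib)
      also have "\<dots> \<le> 2 ^ ?n * (1 + (norm x) ^ (2 * ?n))"
        by (intro mult_left_mono) (auto simp: max_def power_mult)
      finally show ?thesis .
    qed
    finally have le: "(\<Prod>i\<in>UNIV. (1 + (x $ i)\<^sup>2)) \<le> 2 ^ ?n * (1 + (norm x) ^ (2 * ?n))" .
    have "(\<Prod>i\<in>UNIV. (1 + (x $ i)\<^sup>2)) * norm (h x)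
        \<le> 2 ^ ?n * (1 + (norm x) ^ (2 * ?n)) * norm (h x)"
      by (intro mult_right_mono le) auto
    also have "\<dots> = 2 ^ ?n * (norm (h x) + (norm x) ^ (2 * ?n) * norm (h x))"
      by (simp add: algebra_simps)
    also have "\<dots> \<le> 2 ^ ?n * (B + C)"
      by (intro mult_left_mono add_mono B C) auto
    finally have "(\<Prod>i\<in>UNIV. (1 + (x $ i)\<^sup>2)) * norm (h x) \<le> 2 ^ ?n * (B + C)" .
    moreover have "W x = inverse (\<Prod>i\<in>UNIV. (1 + (x $ i)\<^sup>2))"
      using prod_inversef[of "\<lambda>i. 1 + (x $ i)\<^sup>2" UNIV] by (simp only: W_def comp_def)
    moreover have "h' \<le> K * inverse P" if "P * h' \<le> K" "0 < P" for P h' K :: real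
      using that by (simp add: field_simps)
    ultimately show ?thesis using pos by simp
  qed
  then have "norm (h x) \<le> norm (2 ^ ?n * (B + C) * W x)" for x
    unfolding real_norm_def using abs_ge_self by (rule order.trans)
  then have "AE x in lborel. norm (h x) \<le> norm (2 ^ ?n * (B + C) * W x)"
    by (intro AE_I2)
  moreover have "integrable lborel (\<lambda>x. 2 ^ ?n * (B + C) * W x)"
    using W by (rule integrable_mult_right)
  moreover have "h \<in> borel_measurable lborel" by measurable
  ultimately show ?thesis
    using Bochner_Integration.integrable_bound by blast
qed

section \<open>Schwartz functions\<close>

lemma iter_partial_append: "iter_partial (is @ js) f = iter_partial is (iter_partial js f)"
  by (induction "is") auto

lemma schwartz_differentiable: "f \<in> schwartz \<Longrightarrow> f differentiable (at x)"
  unfolding schwartz_def by (drule CollectD, drule spec[of _ "[]"]) auto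

lemma schwartz_continuous_on: "f \<in> schwartz \<Longrightarrow> continuous_on A f"
  by (meson continuous_at_imp_continuous_on differentiable_imp_continuous_within schwartz_differentiable)

lemma schwartz_measurable: "f \<in> schwartz \<Longrightarrow> f \<in> borel_measurable borel"
  by (intro borel_measurable_continuous_onI schwartz_continuous_on)

lemma schwartz_decay:
  assumes "f \<in> schwartz"
  obtains C where "\<And>x. norm x ^ k * norm (f x) \<le> C"
proof -
  have "bounded (range (\<lambda>x. norm x ^ k *\<^sub>R iter_partial [] f x))"
    using assms unfolding schwartz_def by blast
  then obtain C where "\<And>x. norm (norm x ^ k *\<^sub>R iter_partial [] f x) \<le> C"
    unfolding bounded_iff by auto
  then show ?thesis by (intro that[of C]) simp
qed

lemma schwartz_bounded:
  assumes "f \<in> schwartz"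
  obtains C where "\<And>x. norm (f x) \<le> C"
  using schwartz_decay[OF assms, of 0] by auto

lemma schwartz_partial: "f \<in> schwartz \<Longrightarrow> partial i f \<in> schwartz"
proof -
  assume f: "f \<in> schwartz"
  have "iter_partial is (partial i f) = iter_partial (is @ [i]) f" for "is"
    by (simp add: iter_partial_append)
  with f show ?thesis unfolding schwartz_def by auto
qed

lemma schwartz_iter_partial: "f \<in> schwartz \<Longrightarrow> iter_partial is f \<in> schwartz"
  by (induction "is") (auto intro: schwartz_partial)

text \<open>The Schwartz functions are the largest set of rapidly decreasing differentiable functions
  that is closed under partial derivatives.\<close>

lemma schwartz_coinduct:
  assumes diff: "\<And>f x. f \<in> A \<Longrightarrow> f differentiable (at x)"
    and decay: "\<And>f k. f \<in> A \<Longrightarrow> \<exists>C. \<forall>x. norm x ^ k * norm (f x) \<le> C"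
    and partial: "\<And>f i. f \<in> A \<Longrightarrow> partial i f \<in> A"
    and f: "f \<in> A"
  shows "f \<in> schwartz"
proof -
  have "iter_partial is f \<in> A" for "is"
    by (induction "is") (auto intro: f partial)
  then show ?thesis
    using diff decay unfolding schwartz_def bounded_iff by simp
qed

lemma schwartz_integrable:
  fixes f :: "real ^ 'n::finite \<Rightarrow> 'b::{banach,second_countable_topology}"
  assumes "f \<in> schwartz"
  shows "integrable lborel f"
proof -
  obtain B where "\<And>x. norm (f x) \<le> B" using schwartz_bounded[OF assms] by blast
  moreover obtain C where "\<And>x. norm x ^ (2 * CARD('n)) * norm (f x) \<le> C"
    using schwartz_decay[OF assms, of "2 * CARD('n)"] by blast
  ultimately show ?thesis
    using schwartz_measurable[OF assms] by (intro integrable_of_decay)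
qed

lemma partial_eqI: "(f has_derivative f') (at x) \<Longrightarrow> partial i f x = f' (axis i 1)"
  unfolding partial_def by (simp add: frechet_derivative_at[symmetric])

lemma partial_add:
  assumes "\<And>x. f differentiable (at x)" "\<And>x. g differentiable (at x)"
  shows "partial i (\<lambda>x. f x + g x) = (\<lambda>x. partial i f x + partial i g x)"
proof
  fix x
  have "((\<lambda>x. f x + g x) has_derivative
      (\<lambda>h. frechet_derivative f (at x) h + frechet_derivative g (at x) h)) (at x)"
    using assms by (intro has_derivative_add) (simp_all add: frechet_derivative_works)
  from partial_eqI[OF this] show "partial i (\<lambda>x. f x + g x) x = partial i f x + partial i g x"
    by (simp add: partial_def)
qed

lemma partial_mult:
  fixes f g :: "real ^ 'n::finite \<Rightarrow> real"
  assumes "\<And>x. f differentiable (at x)" "\<And>x. g differentiable (at x)"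
  shows "partial i (\<lambda>x. f x * g x) = (\<lambda>x. f x * partial i g x + partial i f x * g x)"
proof
  fix x
  have "((\<lambda>x. f x * g x) has_derivative
      (\<lambda>h. f x * frechet_derivative g (at x) h + frechet_derivative f (at x) h * g x)) (at x)"
    using assms by (intro has_derivative_mult) (simp_all add: frechet_derivative_works)
  from partial_eqI[OF this] show "partial i (\<lambda>x. f x * g x) x = f x * partial i g x + partial i f x * g x"
    by (simp add: partial_def)
qed

text \<open>Finite sums of products of two Schwartz functions. By the Leibniz rule this set is closed
  under partial derivatives, while the set of single products is not.\<close>

inductive_set schwartz_products :: "(real ^ 'n::finite \<Rightarrow> real) set" where
  product: "f \<in> schwartz \<Longrightarrow> g \<in> schwartz \<Longrightarrow> (\<lambda>x. f x * g x) \<in> schwartz_products"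
| sum: "f \<in> schwartz_products \<Longrightarrow> g \<in> schwartz_products \<Longrightarrow> (\<lambda>x. f x + g x) \<in> schwartz_products"

lemma schwartz_products_subset: "f \<in> schwartz_products \<Longrightarrow> f \<in> schwartz"
proof (rule schwartz_coinduct[where A = schwartz_products])
  show diff: "f differentiable (at x)" if "f \<in> schwartz_products"
    for f :: "real ^ 'n \<Rightarrow> real" and x
    using that by induction (auto intro: differentiable_mult differentiable_add schwartz_differentiable)
  show "\<exists>C. \<forall>x. norm x ^ k * norm (f x) \<le> C" if "f \<in> schwartz_products"
    for f :: "real ^ 'n \<Rightarrow> real" and k
    using that
  proof induction
    case (product f g)
    obtain C where C: "\<And>x. norm x ^ k * norm (f x) \<le> C" using schwartz_decay[OF product(1), of k] by blast
    obtain B where B: "\<And>x. norm (g x) \<le> B" using schwartz_bounded[OF product(2)] by blast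
    have "norm x ^ k * norm (f x * g x) \<le> C * B" for x
    proof -
      have "norm x ^ k * norm (f x * g x) = (norm x ^ k * norm (f x)) * norm (g x)"
        by (simp add: abs_mult)
      also have "\<dots> \<le> C * B"
        using order.trans[OF _ C[of 0]] C by (intro mult_mono B C) auto
      finally show ?thesis .
    qed
    then show ?case by blast
  next
    case (sum f g)
    then obtain C D where C: "\<And>x. norm x ^ k * norm (f x) \<le> C"
      and D: "\<And>x. norm x ^ k * norm (g x) \<le> D" by blast
    have "norm x ^ k * norm (f x + g x) \<le> C + D" for x
    proof -
      have "norm x ^ k * norm (f x + g x) \<le> norm x ^ k * (norm (f x) + norm (g x))"
        by (intro mult_left_mono norm_triangle_ineq) auto
      then show ?thesis using C[of x] D[of x] by (simp add: distrib_left)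
    qed
    then show ?case by blast
  qed
  show "partial i f \<in> schwartz_products" if "f \<in> schwartz_products"
    for f :: "real ^ 'n \<Rightarrow> real" and i
    using that
  proof induction
    case (product f g)
    then have "(\<lambda>x. f x * partial i g x + partial i f x * g x) \<in> schwartz_products"
      by (intro schwartz_products.intros schwartz_partial)
    with product show ?case
      by (simp add: partial_mult schwartz_differentiable)
  next
    case (sum f g)
    then show ?case
      by (subst partial_add) (auto intro: diff schwartz_products.sum)
  qed
qed

lemma norm_gradient_squared: "(norm (gradient f y))\<^sup>2 = (\<Sum>i\<in>UNIV. (partial i f y)\<^sup>2)"
  by (simp add: gradient_def norm_vec_def L2_set_def sum_nonneg)

lemma schwartz_norm_gradient_squared:
  fixes f :: "real ^ 'n::finite \<Rightarrow> real"
  assumes f: "f \<in> schwartz"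
  shows "(\<lambda>y. (norm (gradient f y))\<^sup>2) \<in> schwartz"
proof -
  have "(\<lambda>y. \<Sum>i\<in>I. (partial i f y)\<^sup>2) \<in> schwartz_products" if "finite I" "I \<noteq> {}" for I
    using that
  proof (induction I rule: finite_ne_induct)
    case (singleton i)
    then show ?case
      by (auto simp: power2_eq_square intro!: schwartz_products.product schwartz_partial f)
  next
    case (insert i I)
    then show ?case
      by (auto simp: power2_eq_square intro!: schwartz_products.intros schwartz_partial f)
  qed
  then show ?thesis
    unfolding norm_gradient_squared by (intro schwartz_products_subset) auto
qed

lemma schwartz_has_derivative:
  fixes f :: "real ^ 'n::finite \<Rightarrow> real"
  assumes "f \<in> schwartz"
  shows "(f has_derivative (\<lambda>h. h \<bullet> gradient f x)) (at x)"
  using GDERIV_gradient[OF schwartz_differentiable[OF assms]] by (simp add: gderiv_def)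

section \<open>The Gaussian density\<close>

text \<open>The standard normal density on \<open>\<real>\<^sup>n\<close>.\<close>

definition gauss :: "real ^ 'n::finite \<Rightarrow> real"
  where "gauss z = (\<Prod>i\<in>UNIV. std_normal_density (z $ i))"

lemma norm_squared_cart: "(norm (z :: real ^ 'n::finite))\<^sup>2 = (\<Sum>i\<in>UNIV. (z $ i)\<^sup>2)"
  by (simp add: norm_vec_def L2_set_def sum_nonneg)

lemma gauss_eq_exp:
  "gauss (z :: real ^ 'n::finite) = (1 / sqrt (2 * pi)) ^ CARD('n) * exp (- (norm z)\<^sup>2 / 2)"
  unfolding gauss_def std_normal_density_def prod.distrib norm_squared_cart
  by (simp add: exp_sum[symmetric] sum_negf sum_divide_distrib)

lemma gauss_nonneg: "gauss z \<ge> 0"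
  by (simp add: gauss_def prod_nonneg)

lemma gauss_uminus: "gauss (- z) = gauss z"
  by (simp add: gauss_eq_exp)

lemma continuous_on_gauss [continuous_intros]:
  assumes "continuous_on A f"
  shows "continuous_on A (\<lambda>x. gauss (f x))"
  unfolding gauss_eq_exp by (intro continuous_intros assms) auto

lemma gauss_measurable [measurable]: "gauss \<in> borel_measurable borel"
  by (intro borel_measurable_continuous_onI continuous_intros)

lemma
  shows integrable_gauss: "integrable lborel (gauss :: real ^ 'n::finite \<Rightarrow> real)"
    and integral_gauss: "(LINT z|lborel. gauss (z :: real ^ 'n)) = 1"
  using has_bochner_integral_prod_components[of "\<lambda>_ :: 'n. std_normal_density"]
  unfolding gauss_def[symmetric] by (simp_all add: has_bochner_integral_iff)

lemma integrable_norm_gauss: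
  "integrable lborel (\<lambda>z :: real ^ 'n::finite. norm z * gauss z)"
proof -
  have "integrable lborel (\<lambda>z :: real ^ 'n. \<bar>z $ i\<bar> * gauss z)" for i
  proof -
    define f where "f j = (\<lambda>x. (if j = i then \<bar>x\<bar> else 1) * std_normal_density x)" for j
    have "integrable lborel (f j)" for j
      using integrable_std_normal_moment_abs[of 1] by (cases "j = i") (simp_all add: f_def mult.commute)
    then have "integrable lborel (\<lambda>z :: real ^ 'n. \<Prod>j\<in>UNIV. f j (z $ j))"
      using has_bochner_integral_prod_components[of f] by (simp add: has_bochner_integral_iff)
    moreover have "(\<Prod>j\<in>UNIV. f j (z $ j)) = \<bar>z $ i\<bar> * gauss z" for z :: "real ^ 'n"
      by (simp add: f_def gauss_def prod.distrib)
    ultimately show ?thesis by simp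
  qed
  then have int: "integrable lborel (\<lambda>z :: real ^ 'n. \<Sum>i\<in>UNIV. \<bar>z $ i\<bar> * gauss z)"
    by (intro Bochner_Integration.integrable_sum)
  have le: "norm z * gauss z \<le> (\<Sum>i\<in>UNIV. \<bar>z $ i\<bar> * gauss z)" for z :: "real ^ 'n"
    unfolding sum_distrib_right[symmetric]
    by (intro mult_right_mono norm_le_l1_cart gauss_nonneg)
  show ?thesis
  proof (rule Bochner_Integration.integrable_bound[OF int])
    show "AE z :: real ^ 'n in lborel. norm (norm z * gauss z) \<le> norm (\<Sum>i\<in>UNIV. \<bar>z $ i\<bar> * gauss z)"
      using le by (intro AE_I2) (simp add: abs_mult gauss_nonneg sum_nonneg)
  qed measurable
qed

lemma has_derivative_gauss:
  "(gauss has_derivative (\<lambda>h. - (h \<bullet> z) * gauss z)) (at (z :: real ^ 'n::finite))"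
proof -
  have "((\<lambda>z. (1 / sqrt (2 * pi)) ^ CARD('n) * exp (- (z \<bullet> z) / 2)) has_derivative
      (\<lambda>h. - (h \<bullet> z) * ((1 / sqrt (2 * pi)) ^ CARD('n) * exp (- (z \<bullet> z) / 2)))) (at z)"
    by (auto intro!: derivative_eq_intros simp: inner_commute)
  then show ?thesis
    unfolding gauss_eq_exp[abs_def] power2_norm_eq_inner .
qed

lemma cis_sum: "cis (\<Sum>i\<in>I. f i) = (\<Prod>i\<in>I. cis (f i))"
  by (induction I rule: infinite_finite_induct) (simp_all add: cis_mult[symmetric])

lemma integral_cis_std_normal:
  "(LINT x|lborel. cis (x * t) * complex_of_real (std_normal_density x))
     = complex_of_real (exp (- t\<^sup>2 / 2))"
proof -
  have "complex_of_real (exp (- t\<^sup>2 / 2)) = char std_normal_distribution t"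
    by (simp add: char_std_normal_distribution)
  also have "\<dots> = (LINT x|lborel. std_normal_density x *\<^sub>R cis (t * x))"
    unfolding char_def cis_conv_exp by (subst integral_density) auto
  finally show ?thesis
    by (simp add: scaleR_conv_of_real mult.commute)
qed

lemma integral_cis_gauss:
  "(LINT z|lborel. cis (z \<bullet> \<xi>) * complex_of_real (gauss z))
     = complex_of_real (exp (- (norm (\<xi> :: real ^ 'n::finite))\<^sup>2 / 2))"
proof -
  let ?f = "\<lambda>i x. cis (x * \<xi> $ i) * complex_of_real (std_normal_density x)"
  have int: "integrable lborel (?f i)" for i
  proof (rule Bochner_Integration.integrable_bound)
    show "integrable lborel std_normal_density" by simp
    have "continuous_on UNIV (\<lambda>x. cis (x * \<xi> $ i))" by (intro continuous_intros)
    then have [measurable]: "(\<lambda>x. cis (x * \<xi> $ i)) \<in> borel_measurable borel"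
      by (rule borel_measurable_continuous_onI)
    show "?f i \<in> borel_measurable lborel" by measurable
  qed (simp add: norm_mult)
  have "cis (z \<bullet> \<xi>) * complex_of_real (gauss z) = (\<Prod>i\<in>UNIV. ?f i (z $ i))" for z :: "real ^ 'n"
    by (simp add: gauss_def inner_vec_def cis_sum prod.distrib)
  then have "(LINT z|lborel. cis (z \<bullet> \<xi>) * complex_of_real (gauss z))
      = (\<Prod>i\<in>UNIV. complex_of_real (exp (- (\<xi> $ i)\<^sup>2 / 2)))"
    using has_bochner_integral_prod_components[of ?f, OF int]
    by (simp add: has_bochner_integral_iff integral_cis_std_normal)
  also have "\<dots> = complex_of_real (exp (- (norm \<xi>)\<^sup>2 / 2))"
    unfolding norm_squared_cart of_real_prod[symmetric]
    by (simp add: exp_sum[symmetric] sum_negf sum_divide_distrib)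
  finally show ?thesis .
qed

lemma integrable_gauss_scaled: "s > 0 \<Longrightarrow> integrable lborel (\<lambda>z. gauss (s *\<^sub>R z))"
  using integrable_lborel_affine[OF integrable_gauss, of s 0] by simp

lemma cis_inner_measurable [measurable]:
  assumes [measurable]: "f \<in> M \<rightarrow>\<^sub>M borel" "g \<in> M \<rightarrow>\<^sub>M (borel :: (real ^ 'n::finite) measure)"
  shows "(\<lambda>x. cis (f x \<bullet> g x)) \<in> borel_measurable M"
  unfolding cis_conv_exp by measurable

text \<open>A Gaussian in frequency space, dilated by \<open>s\<close>, transforms to the dilation by \<open>1/s\<close>.\<close>

lemma integral_cis_gauss_scaled:
  fixes w :: "real ^ 'n::finite"
  assumes s: "s > 0"
  shows "(LINT \<xi>|lborel. cis (w \<bullet> \<xi>) * complex_of_real (exp (- (s * norm \<xi>)\<^sup>2 / 2)))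
      = complex_of_real ((2 * pi) ^ CARD('n) / s ^ CARD('n) * gauss ((1 / s) *\<^sub>R w))"
proof -
  let ?n = "CARD('n)"
  let ?u = "(1 / s) *\<^sub>R w"
  let ?k = "sqrt (2 * pi) ^ ?n"
  have exp_eq: "exp (- (norm \<zeta>)\<^sup>2 / 2) = ?k * gauss \<zeta>" for \<zeta> :: "real ^ 'n"
    by (simp add: gauss_eq_exp power_divide)
  let ?F = "\<lambda>z. cis (z \<bullet> ?u) * complex_of_real (gauss z)"
  have scale: "?F (0 + s *\<^sub>R \<xi>) = cis (w \<bullet> \<xi>) * complex_of_real (gauss (s *\<^sub>R \<xi>))" for \<xi>
    using s by (simp add: inner_commute)
  have F: "?F \<in> borel_measurable borel" by measurable
  have "complex_of_real (?k * gauss ?u) = (LINT z|lborel. ?F z)"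
    unfolding integral_cis_gauss exp_eq[symmetric] ..
  also have "\<dots> = s ^ ?n *\<^sub>R (LINT \<xi>|lborel. cis (w \<bullet> \<xi>) * complex_of_real (gauss (s *\<^sub>R \<xi>)))"
    using integral_lborel_affine[OF F s, of 0] unfolding scale by simp
  finally have *: "(LINT \<xi>|lborel. cis (w \<bullet> \<xi>) * complex_of_real (gauss (s *\<^sub>R \<xi>)))
      = complex_of_real (?k * gauss ?u) / of_real (s ^ ?n)"
    using s by (simp add: scaleR_conv_of_real)
  have exp_s: "exp (- (s * norm \<xi>)\<^sup>2 / 2) = ?k * gauss (s *\<^sub>R \<xi>)" for \<xi> :: "real ^ 'n"
    using s unfolding exp_eq[symmetric] by simp
  have "(LINT \<xi>|lborel. cis (w \<bullet> \<xi>) * complex_of_real (exp (- (s * norm \<xi>)\<^sup>2 / 2)))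
      = (LINT \<xi>|lborel. of_real ?k * (cis (w \<bullet> \<xi>) * complex_of_real (gauss (s *\<^sub>R \<xi>))))"
    unfolding exp_s of_real_mult by (simp only: mult.left_commute)
  also have "\<dots> = of_real ?k * (LINT \<xi>|lborel. cis (w \<bullet> \<xi>) * complex_of_real (gauss (s *\<^sub>R \<xi>)))"
    by (rule integral_mult_right_zero)
  also have "\<dots> = complex_of_real (?k * ?k / s ^ ?n * gauss ?u)"
    unfolding * by (simp only: of_real_mult of_real_divide times_divide_eq_left times_divide_eq_right mult.assoc)
  also have "?k * ?k = (2 * pi) ^ ?n"
    by (subst power_mult_distrib[symmetric]) simp
  finally show ?thesis .
qed

section \<open>The Fourier transform of a Schwartz function\<close>

lemma integrable_cis_mult:
  fixes f :: "'a \<Rightarrow> real ^ 'n::finite"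
  assumes h: "integrable M h" and [measurable]: "f \<in> M \<rightarrow>\<^sub>M borel" "g \<in> M \<rightarrow>\<^sub>M borel"
  shows "integrable M (\<lambda>x. cis (f x \<bullet> g x) * h x)"
proof (rule Bochner_Integration.integrable_bound[OF h])
  have [measurable]: "h \<in> borel_measurable M" using h by simp
  show "(\<lambda>x. cis (f x \<bullet> g x) * h x) \<in> borel_measurable M" by measurable
qed (simp add: norm_mult)

lemma fourier_measurable:
  assumes [measurable]: "g \<in> borel_measurable borel"
  shows "fourier g \<in> borel_measurable borel"
proof -
  have "(\<lambda>(\<xi>, x). cis (x \<bullet> - \<xi>) * g x) \<in> borel_measurable (borel \<Otimes>\<^sub>M lborel)"
    by measurable
  then have "(\<lambda>\<xi>. LINT x|lborel. cis (x \<bullet> - \<xi>) * g x) \<in> borel_measurable borel"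
    by (rule lborel.borel_measurable_lebesgue_integral)
  then show ?thesis by (simp add: fourier_def[abs_def])
qed

lemma norm_fourier_le:
  "norm (fourier g \<xi>) \<le> (LINT x|lborel. norm (g x))"
proof -
  have "norm (fourier g \<xi>) \<le> (LINT x|lborel. norm (cis (- (x \<bullet> \<xi>)) * g x))"
    unfolding fourier_def by (rule integral_norm_bound)
  then show ?thesis by (simp add: norm_mult)
qed

text \<open>The Fourier transform of a real-valued function.\<close>

abbreviation fourier_real :: "(real ^ 'n::finite \<Rightarrow> real) \<Rightarrow> real ^ 'n \<Rightarrow> complex"
  where "fourier_real g \<equiv> fourier (\<lambda>y. complex_of_real (g y))"

lemma fourier_real_measurable:
  "g \<in> schwartz \<Longrightarrow> fourier_real g \<in> borel_measurable borel"
  using schwartz_measurable[of g] by (intro fourier_measurable) simp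

lemma fourier_partial:
  fixes g :: "real ^ 'n::finite \<Rightarrow> real"
  assumes g: "g \<in> schwartz"
  shows "fourier_real (partial i g) \<xi> = \<i> * of_real (\<xi> $ i) * fourier_real g \<xi>"
proof -
  \<comment> \<open>integrating the derivative of \<open>F\<close>, the integrand of the Fourier transform, gives zero\<close>
  define e where "e y = cis (y \<bullet> - \<xi>)" for y :: "real ^ 'n"
  define F where "F y = e y * complex_of_real (g y)" for y
  define F' where "F' y h = e y * complex_of_real (h \<bullet> gradient g y)
      + ((h \<bullet> - \<xi>) *\<^sub>R (\<i> * e y)) * complex_of_real (g y)" for y h
  have F'_axis: "F' y (axis i 1) = e y * complex_of_real (partial i g y)
      - \<i> * of_real (\<xi> $ i) * (e y * complex_of_real (g y))" for y
    by (simp add: F'_def inner_axis' gradient_def scaleR_conv_of_real)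
  have int: "integrable lborel (\<lambda>y. e y * complex_of_real (h y))" if "h \<in> schwartz" for h
    unfolding e_def using schwartz_integrable[OF that] by (intro integrable_cis_mult) auto
  have "(LINT y|lborel. F' y (axis i 1)) = 0"
  proof (rule integral_directional_derivative_eq_0)
    show "(F has_derivative F' y) (at y)" for y
      unfolding F_def[abs_def] F'_def[abs_def] e_def
      by (intro has_derivative_mult has_derivative_cis has_derivative_of_real
          has_derivative_inner_left has_derivative_ident schwartz_has_derivative g)
    show "continuous_on UNIV (\<lambda>y. F' y (axis i 1))"
      unfolding F'_axis e_def
      by (intro continuous_intros schwartz_continuous_on schwartz_partial g)
    show "integrable lborel F"
      unfolding F_def[abs_def] by (intro int g)
    show "integrable lborel (\<lambda>y. F' y (axis i 1))"
      unfolding F'_axis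
      by (intro Bochner_Integration.integrable_diff integrable_mult_right int g schwartz_partial)
  qed
  also have "(LINT y|lborel. F' y (axis i 1)) = (LINT y|lborel. e y * complex_of_real (partial i g y))
      - \<i> * of_real (\<xi> $ i) * (LINT y|lborel. e y * complex_of_real (g y))"
    unfolding F'_axis
    by (simp add: int g schwartz_partial)
  finally show ?thesis
    by (simp add: fourier_def e_def)
qed

lemma fourier_iter_partial:
  fixes g :: "real ^ 'n::finite \<Rightarrow> real"
  assumes g: "g \<in> schwartz"
  shows "fourier_real (iter_partial (replicate k i) g) \<xi> = (\<i> * of_real (\<xi> $ i)) ^ k * fourier_real g \<xi>"
proof (induction k)
  case (Suc k)
  have "fourier_real (iter_partial (replicate (Suc k) i) g) \<xi>
      = fourier_real (partial i (iter_partial (replicate k i) g)) \<xi>" by simp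
  also have "\<dots> = \<i> * of_real (\<xi> $ i) * fourier_real (iter_partial (replicate k i) g) \<xi>"
    by (rule fourier_partial[OF schwartz_iter_partial[OF g]])
  finally show ?case by (simp add: Suc)
qed simp

text \<open>Each power \<open>\<bar>\<xi>\<^sub>i\<bar>\<^sup>k\<close> is absorbed by \<open>k\<close> derivatives in direction \<open>i\<close>, so pure partial derivatives
  suffice: \<open>|\<xi>|\<close> is at most \<open>n\<close> times the largest coordinate.\<close>

lemma fourier_decay:
  fixes g :: "real ^ 'n::finite \<Rightarrow> real"
  assumes g: "g \<in> schwartz"
  obtains C where "\<And>\<xi>. norm \<xi> ^ k * norm (fourier_real g \<xi>) \<le> C"
proof -
  define B where "B i = (LINT x|lborel. norm (complex_of_real (iter_partial (replicate k i) g x)))" for i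
  have B: "\<bar>\<xi> $ i\<bar> ^ k * norm (fourier_real g \<xi>) \<le> B i" for \<xi> i
  proof -
    have "\<bar>\<xi> $ i\<bar> ^ k * norm (fourier_real g \<xi>) = norm (fourier_real (iter_partial (replicate k i) g) \<xi>)"
      by (simp add: fourier_iter_partial[OF g] norm_mult norm_power)
    also have "\<dots> \<le> B i" unfolding B_def by (rule norm_fourier_le)
    finally show ?thesis .
  qed
  have B_nonneg: "B i \<ge> 0" for i unfolding B_def by simp
  have "norm \<xi> ^ k * norm (fourier_real g \<xi>) \<le> real CARD('n) ^ k * (\<Sum>i\<in>UNIV. B i)" for \<xi> :: "real ^ 'n"
  proof -
    \<comment> \<open>a coordinate of largest modulus\<close>
    obtain i where i: "\<And>j. \<bar>\<xi> $ j\<bar> \<le> \<bar>\<xi> $ i\<bar>"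
    proof -
      have "Max (range (\<lambda>j. \<bar>\<xi> $ j\<bar>)) \<in> range (\<lambda>j. \<bar>\<xi> $ j\<bar>)" by (intro Max_in) auto
      then obtain i where "Max (range (\<lambda>j. \<bar>\<xi> $ j\<bar>)) = \<bar>\<xi> $ i\<bar>" by blast
      then show ?thesis using that[of i] Max_ge[of "range (\<lambda>j. \<bar>\<xi> $ j\<bar>)"] by auto
    qed
    have "norm \<xi> \<le> (\<Sum>j\<in>UNIV. \<bar>\<xi> $ j\<bar>)" by (rule norm_le_l1_cart)
    also have "\<dots> \<le> real CARD('n) * \<bar>\<xi> $ i\<bar>" by (rule sum_bounded_above) (rule i)
    finally have "norm \<xi> ^ k \<le> (real CARD('n) * \<bar>\<xi> $ i\<bar>) ^ k" by (intro power_mono) auto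
    then have "norm \<xi> ^ k * norm (fourier_real g \<xi>)
        \<le> real CARD('n) ^ k * (\<bar>\<xi> $ i\<bar> ^ k * norm (fourier_real g \<xi>))"
      by (simp add: mult_right_mono power_mult_distrib mult.assoc[symmetric])
    also have "\<dots> \<le> real CARD('n) ^ k * B i" by (intro mult_left_mono B) simp
    also have "\<dots> \<le> real CARD('n) ^ k * (\<Sum>i\<in>UNIV. B i)"
      by (intro mult_left_mono member_le_sum B_nonneg) auto
    finally show ?thesis .
  qed
  then show ?thesis using that by blast
qed

lemma integrable_power_fourier:
  fixes g :: "real ^ 'n::finite \<Rightarrow> real"
  assumes g: "g \<in> schwartz"
  shows "integrable lborel (\<lambda>\<xi>. norm \<xi> ^ k * norm (fourier_real g \<xi>))"
proof -
  note [measurable] = fourier_real_measurable[OF g]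
  obtain B where B: "\<And>\<xi>. norm \<xi> ^ k * norm (fourier_real g \<xi>) \<le> B"
    using fourier_decay[OF g, of k] by blast
  obtain C where C: "\<And>\<xi>. norm \<xi> ^ (2 * CARD('n) + k) * norm (fourier_real g \<xi>) \<le> C"
    using fourier_decay[OF g, of "2 * CARD('n) + k"] by blast
  show ?thesis
    using B C by (intro integrable_of_decay[of _ B C]) (simp_all add: power_add mult.assoc)
qed

lemma integrable_fourier:
  assumes g: "g \<in> schwartz"
  shows "integrable lborel (fourier_real g)"
  using integrable_power_fourier[OF g, of 0] fourier_real_measurable[OF g]
  by (simp add: integrable_norm_iff)

lemma integrable_powr_fourier:
  fixes g :: "real ^ 'n::finite \<Rightarrow> real"
  assumes g: "g \<in> schwartz" and \<alpha>: "0 \<le> \<alpha>" "\<alpha> \<le> 2"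
  shows "integrable lborel (\<lambda>\<xi>. norm \<xi> powr \<alpha> * norm (fourier_real g \<xi>))"
proof (rule Bochner_Integration.integrable_bound)
  note [measurable] = fourier_real_measurable[OF g]
  show "integrable lborel (\<lambda>\<xi>. norm \<xi> ^ 0 * norm (fourier_real g \<xi>) + norm \<xi> ^ 2 * norm (fourier_real g \<xi>))"
    by (intro Bochner_Integration.integrable_add integrable_power_fourier g)
  show "(\<lambda>\<xi>. norm \<xi> powr \<alpha> * norm (fourier_real g \<xi>)) \<in> borel_measurable lborel"
    by measurable
  show "AE \<xi> in lborel. norm (norm \<xi> powr \<alpha> * norm (fourier_real g \<xi>))
      \<le> norm (norm \<xi> ^ 0 * norm (fourier_real g \<xi>) + norm \<xi> ^ 2 * norm (fourier_real g \<xi>))"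
  proof (rule AE_I2)
    fix \<xi> :: "real ^ 'n"
    have "norm \<xi> powr \<alpha> \<le> 1 + norm \<xi> ^ 2"
    proof (cases "norm \<xi> \<le> 1")
      case True
      then have "norm \<xi> powr \<alpha> \<le> 1" using \<alpha> by (intro powr_le1) auto
      then show ?thesis by (simp add: add_increasing2)
    next
      case False
      then have "norm \<xi> powr \<alpha> \<le> norm \<xi> powr 2" using \<alpha> by (intro powr_mono) auto
      also have "\<dots> = norm \<xi> ^ 2" using False by (intro powr_numeral) auto
      finally show ?thesis by simp
    qed
    then have "norm \<xi> powr \<alpha> * norm (fourier_real g \<xi>) \<le> (1 + norm \<xi> ^ 2) * norm (fourier_real g \<xi>)"
      by (intro mult_right_mono) auto
    then show "norm (norm \<xi> powr \<alpha> * norm (fourier_real g \<xi>))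
      \<le> norm (norm \<xi> ^ 0 * norm (fourier_real g \<xi>) + norm \<xi> ^ 2 * norm (fourier_real g \<xi>))"
      by (simp add: distrib_right abs_mult)
  qed
qed

section \<open>Gaussian means and Fourier inversion\<close>

text \<open>The mean of \<open>g\<close> around \<open>x\<close> at scale \<open>s\<close>, that is, the solution of the heat equation with
  initial value \<open>g\<close> at time \<open>s\<^sup>2/2\<close>.\<close>

definition gauss_mean :: "real \<Rightarrow> (real ^ 'n::finite \<Rightarrow> real) \<Rightarrow> real ^ 'n \<Rightarrow> real"
  where "gauss_mean s g x = (LINT z|lborel. gauss z * g (x + s *\<^sub>R z))"

lemma integrable_gauss_mean:
  assumes g: "g \<in> schwartz"
  shows "integrable lborel (\<lambda>z. gauss z * g (x + s *\<^sub>R z))"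
proof -
  obtain B where B: "\<And>x. norm (g x) \<le> B" using schwartz_bounded[OF g] by blast
  note [measurable] = schwartz_measurable[OF g]
  show ?thesis
  proof (rule Bochner_Integration.integrable_bound)
    show "integrable lborel (\<lambda>z. gauss z * B)" by (intro integrable_mult_left integrable_gauss)
    show "AE z in lborel. norm (gauss z * g (x + s *\<^sub>R z)) \<le> norm (gauss z * B)"
      using B by (intro AE_I2) (auto simp: abs_mult gauss_nonneg intro!: mult_left_mono order.trans[OF B abs_ge_self, simplified])
  qed measurable
qed

lemma gauss_mean_0: "gauss_mean 0 g x = g x"
  by (simp add: gauss_mean_def integral_gauss)

text \<open>Inserting the Gaussian factor makes the double integral absolutely convergent, so Fubini's
  theorem applies without any inversion formula. The inner integral over the frequency is, up
  to the factor \<open>(2 \<pi>)\<^sup>n\<close>, the heat kernel at time \<open>s\<^sup>2/2\<close>.\<close>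

lemma inverse_fourier_gauss_mean_pos:
  fixes g :: "real ^ 'n::finite \<Rightarrow> real"
  assumes g: "g \<in> schwartz" and s: "s > 0"
  shows "inverse_fourier (\<lambda>\<xi>. complex_of_real (exp (- (s * norm \<xi>)\<^sup>2 / 2)) * fourier_real g \<xi>) x
    = complex_of_real (gauss_mean s g x)"
proof -
  let ?n = "CARD('n)"
  let ?e = "\<lambda>\<xi> :: real ^ 'n. complex_of_real (exp (- (s * norm \<xi>)\<^sup>2 / 2))"
  note [measurable] = schwartz_measurable[OF g]
  define f where "f \<xi> y = cis ((x - y) \<bullet> \<xi>) * ?e \<xi> * complex_of_real (g y)" for \<xi> y
  have norm_f: "norm (f \<xi> y) = exp (- (s * norm \<xi>)\<^sup>2 / 2) * \<bar>g y\<bar>" for \<xi> y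
    by (simp add: f_def norm_mult)
  have exp_eq: "exp (- (s * norm \<xi>)\<^sup>2 / 2) = sqrt (2 * pi) ^ ?n * gauss (s *\<^sub>R \<xi>)" for \<xi> :: "real ^ 'n"
    using s by (simp add: gauss_eq_exp power_divide)
  have int_e: "integrable lborel (\<lambda>\<xi> :: real ^ 'n. exp (- (s * norm \<xi>)\<^sup>2 / 2))"
    unfolding exp_eq using s by (intro integrable_mult_right integrable_gauss_scaled)
  have int_f: "integrable (lborel \<Otimes>\<^sub>M lborel) (\<lambda>(\<xi>, y). f \<xi> y)"
  proof (rule lborel_pair.Fubini_integrable)
    show "(\<lambda>(\<xi>, y). f \<xi> y) \<in> borel_measurable (lborel \<Otimes>\<^sub>M lborel)"
      unfolding f_def by measurable
    show "integrable lborel (\<lambda>\<xi>. LINT y|lborel. norm (case (\<xi>, y) of (\<xi>, y) \<Rightarrow> f \<xi> y))"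
      unfolding prod.case norm_f integral_mult_right_zero by (intro integrable_mult_left int_e)
    have "integrable lborel (\<lambda>y. cis ((x - y) \<bullet> \<xi>) * (?e \<xi> * complex_of_real (g y)))" for \<xi>
      using schwartz_integrable[OF g] by (intro integrable_cis_mult integrable_mult_right) auto
    then show "AE \<xi> in lborel. integrable lborel (\<lambda>y. case (\<xi>, y) of (\<xi>, y) \<Rightarrow> f \<xi> y)"
      by (simp add: f_def mult.assoc)
  qed
  have f_inner: "(LINT y|lborel. f \<xi> y) = cis (x \<bullet> \<xi>) * (?e \<xi> * fourier_real g \<xi>)" for \<xi>
  proof -
    have "f \<xi> y = cis (x \<bullet> \<xi>) * ?e \<xi> * (cis (- (y \<bullet> \<xi>)) * complex_of_real (g y))" for y
      by (simp add: f_def cis_mult inner_diff_left)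
    then show ?thesis by (simp add: fourier_def)
  qed
  define K where "K = (2 * pi) ^ ?n / s ^ ?n"
  have f_outer: "(LINT \<xi>|lborel. f \<xi> y) = complex_of_real (K * (gauss ((1 / s) *\<^sub>R (x - y)) * g y))" for y
  proof -
    have "(LINT \<xi>|lborel. f \<xi> y) = (LINT \<xi>|lborel. cis ((x - y) \<bullet> \<xi>) * ?e \<xi>) * complex_of_real (g y)"
      unfolding f_def by (rule integral_mult_left_zero)
    then show ?thesis
      unfolding integral_cis_gauss_scaled[OF s] K_def by simp
  qed
  have "(LINT \<xi>|lborel. cis (x \<bullet> \<xi>) * (?e \<xi> * fourier_real g \<xi>)) = (LINT \<xi>|lborel. LINT y|lborel. f \<xi> y)"
    by (simp add: f_inner)
  also have "\<dots> = (LINT y|lborel. LINT \<xi>|lborel. f \<xi> y)"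
    by (rule lborel_pair.Fubini_integral[symmetric, OF int_f])
  also have "\<dots> = complex_of_real (K * (LINT y|lborel. gauss ((1 / s) *\<^sub>R (x - y)) * g y))"
    unfolding f_outer integral_complex_of_real integral_mult_right_zero ..
  also have "(LINT y|lborel. gauss ((1 / s) *\<^sub>R (x - y)) * g y)
      = s ^ ?n * (LINT z|lborel. gauss ((1 / s) *\<^sub>R (x - (x + s *\<^sub>R z))) * g (x + s *\<^sub>R z))"
    by (subst integral_lborel_affine[OF _ s, of _ x]) simp_all
  also have "(LINT z|lborel. gauss ((1 / s) *\<^sub>R (x - (x + s *\<^sub>R z))) * g (x + s *\<^sub>R z)) = gauss_mean s g x"
    using s by (simp add: gauss_mean_def gauss_uminus)
  also have "K * (s ^ ?n * gauss_mean s g x) = (2 * pi) ^ ?n * gauss_mean s g x"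
    using s by (simp add: K_def)
  finally show ?thesis
    by (simp add: inverse_fourier_def)
qed

text \<open>Fourier inversion, as the limit \<open>s \<rightarrow> 0\<close>.\<close>

lemma fourier_inversion:
  fixes g :: "real ^ 'n::finite \<Rightarrow> real"
  assumes g: "g \<in> schwartz"
  shows "inverse_fourier (fourier_real g) x = complex_of_real (g x)"
proof -
  define s where "s k = inverse (real (Suc k))" for k
  have s_pos: "s k > 0" for k by (simp add: s_def)
  have s: "s \<longlonglongrightarrow> 0" unfolding s_def[abs_def] by (rule LIMSEQ_inverse_real_of_nat)
  note [measurable] = schwartz_measurable[OF g] fourier_real_measurable[OF g]
  obtain B where B: "\<And>x. norm (g x) \<le> B" using schwartz_bounded[OF g] by blast
  let ?e = "\<lambda>s \<xi> :: real ^ 'n. complex_of_real (exp (- (s * norm \<xi>)\<^sup>2 / 2))"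
  have "(\<lambda>k. LINT \<xi>|lborel. cis (x \<bullet> \<xi>) * (?e (s k) \<xi> * fourier_real g \<xi>))
      \<longlonglongrightarrow> (LINT \<xi>|lborel. cis (x \<bullet> \<xi>) * fourier_real g \<xi>)"
  proof (rule integral_dominated_convergence)
    show "integrable lborel (\<lambda>\<xi>. norm (fourier_real g \<xi>))"
      by (intro integrable_norm integrable_fourier g)
    show "AE \<xi> in lborel. (\<lambda>k. cis (x \<bullet> \<xi>) * (?e (s k) \<xi> * fourier_real g \<xi>))
        \<longlonglongrightarrow> cis (x \<bullet> \<xi>) * fourier_real g \<xi>"
    proof (rule AE_I2)
      fix \<xi> :: "real ^ 'n"
      have "(\<lambda>k. cis (x \<bullet> \<xi>) * (?e (s k) \<xi> * fourier_real g \<xi>))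
          \<longlonglongrightarrow> cis (x \<bullet> \<xi>) * (?e 0 \<xi> * fourier_real g \<xi>)"
        by (intro tendsto_intros s) auto
      then show "(\<lambda>k. cis (x \<bullet> \<xi>) * (?e (s k) \<xi> * fourier_real g \<xi>))
          \<longlonglongrightarrow> cis (x \<bullet> \<xi>) * fourier_real g \<xi>" by simp
    qed
    show "AE \<xi> in lborel. norm (cis (x \<bullet> \<xi>) * (?e (s k) \<xi> * fourier_real g \<xi>)) \<le> norm (fourier_real g \<xi>)" for k
      by (intro AE_I2) (simp add: norm_mult mult_left_le_one_le)
  qed measurable
  then have 1: "(\<lambda>k. complex_of_real (gauss_mean (s k) g x)) \<longlonglongrightarrow> inverse_fourier (fourier_real g) x"
    unfolding inverse_fourier_gauss_mean_pos[OF g s_pos, symmetric] inverse_fourier_def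
    by (intro tendsto_intros) auto
  have "(\<lambda>k. gauss_mean (s k) g x) \<longlonglongrightarrow> gauss_mean 0 g x"
    unfolding gauss_mean_def
  proof (rule integral_dominated_convergence)
    show "integrable lborel (\<lambda>z :: real ^ 'n. gauss z * B)" by (intro integrable_mult_left integrable_gauss)
    show "AE z in lborel. norm (gauss z * g (x + s k *\<^sub>R z)) \<le> gauss z * B" for k
      using B by (intro AE_I2) (simp add: abs_mult gauss_nonneg mult_left_mono)
    have "isCont g y" for y
      using schwartz_differentiable[OF g] by (rule differentiable_imp_continuous_within)
    then show "AE z in lborel. (\<lambda>k. gauss z * g (x + s k *\<^sub>R z)) \<longlonglongrightarrow> gauss z * g (x + 0 *\<^sub>R z)"
      by (intro AE_I2 tendsto_mult tendsto_const isCont_tendsto_compose[of _ g] tendsto_add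
          tendsto_scaleR s)
  qed measurable
  then have "(\<lambda>k. complex_of_real (gauss_mean (s k) g x)) \<longlonglongrightarrow> complex_of_real (g x)"
    unfolding gauss_mean_0 by (rule tendsto_of_real)
  with 1 show ?thesis by (rule LIMSEQ_unique)
qed

text \<open>This includes \<open>s = 0\<close>, where both sides vanish.\<close>

lemma inverse_fourier_gauss_mean:
  fixes g :: "real ^ 'n::finite \<Rightarrow> real"
  assumes g: "g \<in> schwartz" and s: "s \<ge> 0"
  shows "inverse_fourier (\<lambda>\<xi>. complex_of_real (1 - exp (- (s * norm \<xi>)\<^sup>2 / 2)) * fourier_real g \<xi>) x
    = complex_of_real (g x - gauss_mean s g x)"
proof (cases "s = 0")
  case True
  then show ?thesis by (simp add: inverse_fourier_def gauss_mean_0)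
next
  case False
  let ?e = "\<lambda>\<xi> :: real ^ 'n. complex_of_real (exp (- (s * norm \<xi>)\<^sup>2 / 2))"
  note [measurable] = fourier_real_measurable[OF g]
  have 1: "integrable lborel (\<lambda>\<xi>. cis (x \<bullet> \<xi>) * fourier_real g \<xi>)"
    by (intro integrable_cis_mult integrable_fourier g) auto
  have 2: "integrable lborel (\<lambda>\<xi>. cis (x \<bullet> \<xi>) * (?e \<xi> * fourier_real g \<xi>))"
  proof (rule Bochner_Integration.integrable_bound[OF integrable_fourier[OF g]])
    show "AE \<xi> in lborel. norm (cis (x \<bullet> \<xi>) * (?e \<xi> * fourier_real g \<xi>)) \<le> norm (fourier_real g \<xi>)"
      by (intro AE_I2) (simp add: norm_mult mult_left_le_one_le)
  qed measurable
  have "complex_of_real (g x - gauss_mean s g x)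
      = inverse_fourier (fourier_real g) x - inverse_fourier (\<lambda>\<xi>. ?e \<xi> * fourier_real g \<xi>) x"
    unfolding fourier_inversion[OF g] using False s
    by (subst inverse_fourier_gauss_mean_pos[OF g]) simp_all
  also have "\<dots> = inverse_fourier (\<lambda>\<xi>. complex_of_real (1 - exp (- (s * norm \<xi>)\<^sup>2 / 2)) * fourier_real g \<xi>) x"
    unfolding inverse_fourier_def diff_divide_distrib[symmetric]
      Bochner_Integration.integral_diff[OF 1 2, symmetric]
    by (simp add: algebra_simps)
  finally show ?thesis by simp
qed

section \<open>The fractional Laplacian as an integral of Gaussian means\<close>

lemma has_bochner_integral_powr_atLeast:
  fixes a e :: real
  assumes e: "e < -1" and a: "a > 0"
  shows "has_bochner_integral lborel (\<lambda>s. indicator {a..} s * s powr e) (- (a powr (e + 1)) / (e + 1))"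
proof -
  have I: "((\<lambda>s. s powr e) has_integral - (a powr (e + 1)) / (e + 1)) {a..}"
    using has_integral_powr_to_inf[OF e a] .
  then have "set_integrable lebesgue {a..} (\<lambda>s. s powr e)"
    by (intro nonnegative_absolutely_integrable_1) auto
  then have "integrable lborel (\<lambda>s. indicator {a..} s * s powr e)"
    by (simp add: set_integrable_def integrable_completion)
  then have *: "set_integrable lborel {a..} (\<lambda>s. s powr e)"
    by (simp add: set_integrable_def)
  have "(LINT s:{a..}|lborel. s powr e) = - (a powr (e + 1)) / (e + 1)"
    using set_borel_integral_eq_integral(2)[OF *] integral_unique[OF I] by simp
  then show ?thesis
    using * by (simp add: has_bochner_integral_iff set_integrable_def set_lebesgue_integral_def)
qed

lemma integrable_powr_Ioc:
  fixes a e :: real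
  assumes e: "e > -1" and a: "a \<ge> 0"
  shows "integrable lborel (\<lambda>s. indicator {0<..a} s * s powr e)"
proof -
  have "set_integrable lebesgue {0<..a} (\<lambda>s. s powr e)"
    using integrable_on_powr_from_0'[OF e a] by (intro nonnegative_absolutely_integrable_1) auto
  then show ?thesis
    by (simp add: set_integrable_def integrable_completion)
qed

text \<open>The weight for which \<open>\<integral> (1 - exp (- (s r)\<^sup>2 / 2)) w(s) ds\<close> is a multiple of \<open>r\<^sup>\<alpha>\<close>, extended by
  zero so that all integrals run over the real line.\<close>

definition weight :: "real \<Rightarrow> real \<Rightarrow> real"
  where "weight \<alpha> s = indicator {0<..} s * s powr (- 1 - \<alpha>)"

text \<open>The factor of proportionality, which is the value of that integral at \<open>r = 1\<close>.\<close>

definition weight_const :: "real \<Rightarrow> real"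
  where "weight_const \<alpha> = (LINT s|lborel. weight \<alpha> s * (1 - exp (- s\<^sup>2 / 2)))"

lemma weight_nonneg: "weight \<alpha> s \<ge> 0"
  by (simp add: weight_def)

lemma weight_measurable [measurable]: "weight \<alpha> \<in> borel_measurable borel"
  unfolding weight_def[abs_def] by measurable

text \<open>Near \<open>0\<close> the integrand is of order \<open>s\<^sup>1\<^sup>-\<^sup>\<alpha>\<close>, which needs \<open>\<alpha> < 2\<close>; at infinity it is of order
  \<open>s\<^sup>-\<^sup>1\<^sup>-\<^sup>\<alpha>\<close>, which needs \<open>\<alpha> > 0\<close>.\<close>

lemma integrable_weight:
  assumes \<alpha>: "0 < \<alpha>" "\<alpha> < 2"
  shows "integrable lborel (\<lambda>s. weight \<alpha> s * (1 - exp (- s\<^sup>2 / 2)))"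
proof (rule Bochner_Integration.integrable_bound)
  show "integrable lborel (\<lambda>s. indicator {0<..1} s * s powr (1 - \<alpha>) + indicator {1..} s * s powr (- 1 - \<alpha>))"
    using \<alpha> by (intro Bochner_Integration.integrable_add integrable_powr_Ioc
        integrable.intros[OF has_bochner_integral_powr_atLeast]) auto
  show "AE s in lborel. norm (weight \<alpha> s * (1 - exp (- s\<^sup>2 / 2)))
      \<le> norm (indicator {0<..1} s * s powr (1 - \<alpha>) + indicator {1..} s * s powr (- 1 - \<alpha>))"
  proof (rule AE_I2)
    fix s :: real
    consider "s \<le> 0" | "0 < s" "s \<le> 1" | "1 < s" by linarith
    then show "norm (weight \<alpha> s * (1 - exp (- s\<^sup>2 / 2)))
      \<le> norm (indicator {0<..1} s * s powr (1 - \<alpha>) + indicator {1..} s * s powr (- 1 - \<alpha>))"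
    proof cases
      case 1
      then show ?thesis by (simp add: weight_def)
    next
      case 2
      have "1 - exp (- s\<^sup>2 / 2) \<le> s\<^sup>2 / 2"
        using exp_ge_add_one_self[of "- s\<^sup>2 / 2"] by linarith
      also have "\<dots> \<le> s powr 2" using 2 by simp
      finally have "s powr (- 1 - \<alpha>) * (1 - exp (- s\<^sup>2 / 2)) \<le> s powr (- 1 - \<alpha>) * s powr 2"
        by (intro mult_left_mono) auto
      also have "\<dots> = s powr (1 - \<alpha>)" by (simp add: powr_add[symmetric])
      finally have "s powr (- 1 - \<alpha>) * (1 - exp (- s\<^sup>2 / 2)) \<le> s powr (1 - \<alpha>)" .
      moreover have "norm (weight \<alpha> s * (1 - exp (- s\<^sup>2 / 2))) = s powr (- 1 - \<alpha>) * (1 - exp (- s\<^sup>2 / 2))"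
        using 2 by (simp add: weight_def abs_mult)
      moreover have "s powr (1 - \<alpha>)
          \<le> norm (indicator {0<..1} s * s powr (1 - \<alpha>) + indicator {1..} s * s powr (- 1 - \<alpha>))"
        using 2 by (simp add: indicator_def)
      ultimately show ?thesis by linarith
    next
      case 3
      have "s powr (- 1 - \<alpha>) * (1 - exp (- s\<^sup>2 / 2)) \<le> s powr (- 1 - \<alpha>) * 1"
        by (intro mult_left_mono) auto
      moreover have "norm (weight \<alpha> s * (1 - exp (- s\<^sup>2 / 2))) = s powr (- 1 - \<alpha>) * (1 - exp (- s\<^sup>2 / 2))"
        using 3 by (simp add: weight_def abs_mult)
      ultimately show ?thesis
        using 3 by simp
    qed
  qed
qed measurable

lemma weight_const_pos:
  assumes \<alpha>: "0 < \<alpha>" "\<alpha> < 2"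
  shows "weight_const \<alpha> > 0"
proof -
  define c where "c = 1 - exp (- (1 / 2) :: real)"
  have c: "c > 0" by (simp add: c_def)
  have I: "has_bochner_integral lborel (\<lambda>s. c * (indicator {1..} s * s powr (- 1 - \<alpha>)))
      (c * (- (1 powr (- 1 - \<alpha> + 1)) / (- 1 - \<alpha> + 1)))"
    using \<alpha> by (intro has_bochner_integral_mult_right has_bochner_integral_powr_atLeast) auto
  have "0 < c * (- (1 powr (- 1 - \<alpha> + 1)) / (- 1 - \<alpha> + 1))"
    using c \<alpha> by simp
  also have "\<dots> = (LINT s|lborel. c * (indicator {1..} s * s powr (- 1 - \<alpha>)))"
    using I by (rule has_bochner_integral_integral_eq[symmetric])
  also have "\<dots> \<le> weight_const \<alpha>"
    unfolding weight_const_def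
  proof (rule integral_mono)
    show "integrable lborel (\<lambda>s. c * (indicator {1..} s * s powr (- 1 - \<alpha>)))"
      using I by (rule integrable.intros)
    show "c * (indicator {1..} s * s powr (- 1 - \<alpha>)) \<le> weight \<alpha> s * (1 - exp (- s\<^sup>2 / 2))" for s :: real
    proof (cases "1 \<le> s")
      case True
      then have "1 \<le> s\<^sup>2" by (simp add: one_le_power)
      then have "c \<le> 1 - exp (- s\<^sup>2 / 2)" by (simp add: c_def)
      then have "s powr (- 1 - \<alpha>) * c \<le> s powr (- 1 - \<alpha>) * (1 - exp (- s\<^sup>2 / 2))"
        by (intro mult_left_mono) auto
      with True show ?thesis by (simp add: weight_def mult.commute)
    next
      case False
      then show ?thesis by (simp add: weight_nonneg)
    qed
  qed (intro integrable_weight \<alpha>)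
  finally show ?thesis .
qed

text \<open>Subordination: the power \<open>r\<^sup>\<alpha>\<close> as a superposition of the symbols of Gaussian means, by
  the substitution \<open>s \<mapsto> r s\<close>.\<close>

lemma has_bochner_integral_weight_scaled:
  assumes \<alpha>: "0 < \<alpha>" "\<alpha> < 2" and r: "r \<ge> 0"
  shows "has_bochner_integral lborel (\<lambda>s. weight \<alpha> s * (1 - exp (- (s * r)\<^sup>2 / 2))) (r powr \<alpha> * weight_const \<alpha>)"
proof (cases "r = 0")
  case False
  with r have r: "r > 0" by simp
  let ?h = "\<lambda>s. weight \<alpha> s * (1 - exp (- s\<^sup>2 / 2))"
  have w: "weight \<alpha> s = r powr (1 + \<alpha>) * weight \<alpha> (0 + r * s)" for s
  proof (cases "s > 0")
    case True
    have "r powr (1 + \<alpha>) * (r powr (- 1 - \<alpha>) * s powr (- 1 - \<alpha>)) = s powr (- 1 - \<alpha>)"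
      using r by (simp add: mult.assoc[symmetric] powr_add[symmetric])
    with True r show ?thesis by (simp add: weight_def powr_mult)
  next
    case False
    with r show ?thesis by (simp add: weight_def zero_less_mult_iff)
  qed
  have eq: "weight \<alpha> s * (1 - exp (- (s * r)\<^sup>2 / 2)) = r powr (1 + \<alpha>) * ?h (0 + r * s)" for s
    unfolding w[of s] by (simp add: mult.commute)
  have int: "integrable lborel ?h" by (rule integrable_weight[OF \<alpha>])
  have "integrable lborel (\<lambda>s. ?h (0 + r * s))"
    using int r by (intro lborel_integrable_real_affine) auto
  moreover have "r powr (1 + \<alpha>) * (LINT s|lborel. ?h (0 + r * s)) = r powr \<alpha> * weight_const \<alpha>"
    unfolding weight_const_def
    using r by (subst (2) lborel_integral_real_affine[of r _ 0]) (auto simp: powr_add)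
  ultimately show ?thesis
    unfolding eq has_bochner_integral_iff by simp
qed (simp add: has_bochner_integral_zero)

text \<open>This replaces the principal value formula for \<open>\<Lambda>\<^sup>\<alpha>\<close>: no singular kernel is needed, since the
  symmetry of the Gaussian makes the difference of \<open>g\<close> and its mean of order \<open>s\<^sup>2\<close> near \<open>s = 0\<close>.\<close>

lemma has_bochner_integral_Lambda:
  fixes g :: "real ^ 'n::finite \<Rightarrow> real"
  assumes g: "g \<in> schwartz" and \<alpha>: "0 < \<alpha>" "\<alpha> < 2"
  shows "has_bochner_integral lborel (\<lambda>s. weight \<alpha> s * (g x - gauss_mean s g x)) (weight_const \<alpha> * Lambda \<alpha> g x)"
proof -
  let ?c = "(2 * pi) ^ CARD('n)"
  note [measurable] = fourier_real_measurable[OF g]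
  \<comment> \<open>integrating over \<open>s\<close> first gives the symbol of \<open>\<Lambda>\<^sup>\<alpha>\<close>, over \<open>\<xi>\<close> first the Gaussian means\<close>
  define h where "h \<xi> s = complex_of_real (weight \<alpha> s * (1 - exp (- (s * norm \<xi>)\<^sup>2 / 2)))
      * (cis (x \<bullet> \<xi>) * fourier_real g \<xi>)" for \<xi> :: "real ^ 'n" and s
  note W = has_bochner_integral_weight_scaled[OF \<alpha> norm_ge_zero]
  have norm_h: "norm (h \<xi> s) = weight \<alpha> s * (1 - exp (- (s * norm \<xi>)\<^sup>2 / 2)) * norm (fourier_real g \<xi>)" for \<xi> s
  proof -
    have "0 \<le> weight \<alpha> s * (1 - exp (- (s * norm \<xi>)\<^sup>2 / 2))"
      by (intro mult_nonneg_nonneg weight_nonneg) simp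
    then show ?thesis by (simp only: h_def norm_mult norm_of_real norm_cis abs_of_nonneg mult_1)
  qed
  have int_h: "integrable (lborel \<Otimes>\<^sub>M lborel) (\<lambda>(\<xi>, s). h \<xi> s)"
  proof (rule lborel_pair.Fubini_integrable)
    show "(\<lambda>(\<xi>, s). h \<xi> s) \<in> borel_measurable (lborel \<Otimes>\<^sub>M lborel)"
      unfolding h_def by measurable
    have "(LINT s|lborel. norm (h \<xi> s)) = weight_const \<alpha> * (norm \<xi> powr \<alpha> * norm (fourier_real g \<xi>))" for \<xi>
      unfolding norm_h integral_mult_left_zero has_bochner_integral_integral_eq[OF W] by simp
    then show "integrable lborel (\<lambda>\<xi>. LINT s|lborel. norm (case (\<xi>, s) of (\<xi>, s) \<Rightarrow> h \<xi> s))"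
      using g \<alpha> by (simp add: integrable_powr_fourier)
    have "integrable lborel (h \<xi>)" for \<xi>
      unfolding h_def[abs_def]
      by (intro integrable_mult_left integrable_of_real integrable.intros[OF W])
    then show "AE \<xi> in lborel. integrable lborel (\<lambda>s. case (\<xi>, s) of (\<xi>, s) \<Rightarrow> h \<xi> s)"
      by simp
  qed
  have inner_s: "(LINT s|lborel. h \<xi> s)
      = of_real (weight_const \<alpha>) * (cis (x \<bullet> \<xi>) * (complex_of_real (norm \<xi> powr \<alpha>) * fourier_real g \<xi>))" for \<xi>
    unfolding h_def integral_mult_left_zero integral_complex_of_real
      has_bochner_integral_integral_eq[OF W] by simp
  have inner_\<xi>: "(LINT \<xi>|lborel. h \<xi> s) = complex_of_real (?c * (weight \<alpha> s * (g x - gauss_mean s g x)))" for s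
  proof (cases "s > 0")
    case True
    have "complex_of_real (g x - gauss_mean s g x)
        = (LINT \<xi>|lborel. cis (x \<bullet> \<xi>) * (complex_of_real (1 - exp (- (s * norm \<xi>)\<^sup>2 / 2)) * fourier_real g \<xi>)) / of_real ?c"
      using inverse_fourier_gauss_mean[OF g, of s x] True by (simp only: inverse_fourier_def less_imp_le)
    then have *: "(LINT \<xi>|lborel. cis (x \<bullet> \<xi>) * (complex_of_real (1 - exp (- (s * norm \<xi>)\<^sup>2 / 2)) * fourier_real g \<xi>))
        = of_real ?c * complex_of_real (g x - gauss_mean s g x)"
      by simp
    have "(LINT \<xi>|lborel. h \<xi> s) = (LINT \<xi>|lborel. complex_of_real (weight \<alpha> s) *
        (cis (x \<bullet> \<xi>) * (complex_of_real (1 - exp (- (s * norm \<xi>)\<^sup>2 / 2)) * fourier_real g \<xi>)))"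
      unfolding h_def of_real_mult by (simp only: mult.assoc mult.left_commute)
    also have "\<dots> = complex_of_real (weight \<alpha> s) * (of_real ?c * complex_of_real (g x - gauss_mean s g x))"
      unfolding integral_mult_right_zero * ..
    finally show ?thesis by (simp only: of_real_mult mult.left_commute)
  qed (simp add: h_def weight_def)
  have "integrable lborel (\<lambda>s. LINT \<xi>|lborel. h \<xi> s)"
    using lborel_pair.integrable_snd[OF int_h] .
  then have int: "integrable lborel (\<lambda>s. ?c * (weight \<alpha> s * (g x - gauss_mean s g x)))"
    unfolding inner_\<xi> complex_of_real_integrable_eq .
  have "complex_of_real (LINT s|lborel. ?c * (weight \<alpha> s * (g x - gauss_mean s g x))) = (LINT s|lborel. LINT \<xi>|lborel. h \<xi> s)"
    unfolding inner_\<xi> by (rule integral_complex_of_real[symmetric])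
  also have "\<dots> = (LINT \<xi>|lborel. LINT s|lborel. h \<xi> s)"
    by (rule lborel_pair.Fubini_integral[OF int_h])
  also have "\<dots> = of_real (weight_const \<alpha>) * (of_real ?c * Lambda_complex \<alpha> (\<lambda>y. complex_of_real (g y)) x)"
    unfolding inner_s integral_mult_right_zero Lambda_complex_def inverse_fourier_def by simp
  also have "\<dots> = complex_of_real (?c * (weight_const \<alpha> * Lambda \<alpha> g x))"
    unfolding Lambda_complex_of_real by simp
  finally have "?c * (LINT s|lborel. weight \<alpha> s * (g x - gauss_mean s g x)) = ?c * (weight_const \<alpha> * Lambda \<alpha> g x)"
    unfolding of_real_eq_iff integral_mult_right_zero .
  with int show ?thesis
    by (simp add: has_bochner_integral_iff)
qed

section \<open>The nonlinear lower bound\<close>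

text \<open>By continuity the bound by the essential supremum holds everywhere.\<close>

lemma abs_le_Linf_norm:
  assumes f: "f \<in> schwartz"
  shows "\<bar>f x\<bar> \<le> Linf_norm f"
proof -
  note [measurable] = schwartz_measurable[OF f]
  obtain B where B: "\<And>x. norm (f x) \<le> B" using schwartz_bounded[OF f] by blast
  let ?E = "esssup lborel (\<lambda>x. ereal \<bar>f x\<bar>)"
  have "?E \<le> ereal B" using B by (intro esssup_I) auto
  then have "?E \<noteq> \<infinity>" by auto
  have "AE x in lborel. ereal \<bar>f x\<bar> \<le> ?E" by (rule esssup_AE)
  with \<open>?E \<noteq> \<infinity>\<close> have "AE x in lborel. x \<in> {x. \<bar>f x\<bar> \<le> Linf_norm f}"
    unfolding Linf_norm_def by (cases ?E) auto
  then have "AE x in lebesgue. x \<in> {x. \<bar>f x\<bar> \<le> Linf_norm f}"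
    by (rule AE_completion)
  moreover have "closed {x. \<bar>f x\<bar> \<le> Linf_norm f}"
    by (intro closed_Collect_le continuous_intros schwartz_continuous_on f)
  ultimately have "x \<in> {x. \<bar>f x\<bar> \<le> Linf_norm f}"
    by (intro mem_closed_if_AE_lebesgue)
  then show ?thesis by simp
qed

text \<open>The expression is the Gaussian mean of \<open>|\<nabla>f(x) - \<nabla>f(x + s z)|\<^sup>2\<close>, expanded.\<close>

lemma gauss_mean_square_nonneg:
  fixes f :: "real ^ 'n::finite \<Rightarrow> real"
  assumes f: "f \<in> schwartz"
  shows "0 \<le> (norm (gradient f x))\<^sup>2 - 2 * (\<Sum>i\<in>UNIV. gradient f x $ i * gauss_mean s (partial i f) x)
    + gauss_mean s (\<lambda>y. (norm (gradient f y))\<^sup>2) x"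
proof -
  let ?v = "gradient f x"
  have 1: "integrable lborel (\<lambda>z :: real ^ 'n. (norm ?v)\<^sup>2 * gauss z)"
    by (intro integrable_mult_right integrable_gauss)
  have 2: "integrable lborel (\<lambda>z. ?v $ i * (gauss z * partial i f (x + s *\<^sub>R z)))" for i
    by (intro integrable_mult_right integrable_gauss_mean schwartz_partial f)
  have 3: "integrable lborel (\<lambda>z. gauss z * (norm (gradient f (x + s *\<^sub>R z)))\<^sup>2)"
    by (rule integrable_gauss_mean[OF schwartz_norm_gradient_squared[OF f]])
  have "0 \<le> (LINT z|lborel. gauss z * (norm (?v - gradient f (x + s *\<^sub>R z)))\<^sup>2)"
    by (intro integral_nonneg_AE AE_I2) (simp add: gauss_nonneg)
  also have "\<dots> = (LINT z|lborel. (norm ?v)\<^sup>2 * gauss z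
      - 2 * (\<Sum>i\<in>UNIV. ?v $ i * (gauss z * partial i f (x + s *\<^sub>R z)))
      + gauss z * (norm (gradient f (x + s *\<^sub>R z)))\<^sup>2)"
  proof (rule Bochner_Integration.integral_cong)
    fix z :: "real ^ 'n"
    let ?w = "gradient f (x + s *\<^sub>R z)"
    have "(norm (?v - ?w))\<^sup>2 = (norm ?v)\<^sup>2 - 2 * (?v \<bullet> ?w) + (norm ?w)\<^sup>2"
      by (simp add: power2_norm_eq_inner inner_diff_left inner_diff_right inner_commute)
    moreover have "gauss z * (?v \<bullet> ?w) = (\<Sum>i\<in>UNIV. ?v $ i * (gauss z * partial i f (x + s *\<^sub>R z)))"
      by (simp add: inner_vec_def sum_distrib_left gradient_def mult.left_commute)
    ultimately show "gauss z * (norm (?v - ?w))\<^sup>2 = (norm ?v)\<^sup>2 * gauss z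
      - 2 * (\<Sum>i\<in>UNIV. ?v $ i * (gauss z * partial i f (x + s *\<^sub>R z))) + gauss z * (norm ?w)\<^sup>2"
      by (simp only: right_diff_distrib distrib_left mult.left_commute[of "gauss z" 2] mult.commute[of "gauss z" "(norm ?v)\<^sup>2"])
  qed simp
  also have "\<dots> = (norm ?v)\<^sup>2 - 2 * (\<Sum>i\<in>UNIV. ?v $ i * gauss_mean s (partial i f) x)
      + gauss_mean s (\<lambda>y. (norm (gradient f y))\<^sup>2) x"
    using 1 2 3 by (simp add: integral_gauss gauss_mean_def)
  finally show ?thesis .
qed

text \<open>The first absolute moment of the Gaussian, increased by \<open>1\<close> so that its positivity is
  immediate. The argument only carries the dimension.\<close>

definition gauss_moment :: "'n::finite itself \<Rightarrow> real"
  where "gauss_moment _ = 1 + (LINT z|lborel. norm (z :: real ^ 'n) * gauss z)"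

text \<open>Smoothing: moving the derivative to the Gaussian bounds the mean of a directional
  derivative by the supremum of \<open>f\<close>, with a factor \<open>1/s\<close>.\<close>

lemma gauss_mean_directional_derivative_le:
  fixes f :: "real ^ 'n::finite \<Rightarrow> real"
  assumes f: "f \<in> schwartz" and s: "s > 0"
  shows "(\<Sum>i\<in>UNIV. v $ i * gauss_mean s (partial i f) x)
    \<le> norm v * Linf_norm f * gauss_moment TYPE('n) / s"
proof -
  let ?L = "Linf_norm f"
  \<comment> \<open>The integral of the derivative of \<open>F\<close> in direction \<open>v\<close> vanishes, and its two terms are the mean
    of the derivative of \<open>f\<close> and an integral against the first moment of the Gaussian.\<close>
  define F where "F z = gauss z * f (x + s *\<^sub>R z)" for z
  define F' where "F' z h = gauss z * ((s *\<^sub>R h) \<bullet> gradient f (x + s *\<^sub>R z)) + - (h \<bullet> z) * gauss z * f (x + s *\<^sub>R z)" for z h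
  note [measurable] = schwartz_measurable[OF f]
  have L: "0 \<le> ?L" using abs_le_Linf_norm[OF f, of x] by simp
  have D: "integrable lborel (\<lambda>z. v $ i * (gauss z * partial i f (x + s *\<^sub>R z)))" for i
    by (intro integrable_mult_right integrable_gauss_mean schwartz_partial f)
  have R_le: "norm ((v \<bullet> z) * gauss z * f (x + s *\<^sub>R z)) \<le> norm v * ?L * (norm z * gauss z)" for z
  proof -
    have "norm ((v \<bullet> z) * gauss z * f (x + s *\<^sub>R z)) = \<bar>v \<bullet> z\<bar> * gauss z * \<bar>f (x + s *\<^sub>R z)\<bar>"
      by (simp add: abs_mult gauss_nonneg)
    also have "\<dots> \<le> (norm v * norm z) * gauss z * ?L"
      by (intro mult_mono Cauchy_Schwarz_ineq2 abs_le_Linf_norm f mult_nonneg_nonneg gauss_nonneg) auto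
    finally show ?thesis by (simp add: mult_ac)
  qed
  have int_bound: "integrable lborel (\<lambda>z. norm v * ?L * (norm (z :: real ^ 'n) * gauss z))"
    by (intro integrable_mult_right integrable_norm_gauss)
  have R: "integrable lborel (\<lambda>z. (v \<bullet> z) * gauss z * f (x + s *\<^sub>R z))"
  proof (rule Bochner_Integration.integrable_bound[OF int_bound])
    show "AE z in lborel. norm ((v \<bullet> z) * gauss z * f (x + s *\<^sub>R z)) \<le> norm (norm v * ?L * (norm z * gauss z))"
      unfolding real_norm_def[of "norm v * _ * _"] by (intro AE_I2 order.trans[OF R_le abs_ge_self])
  qed measurable
  have F'_v: "F' z v = s * (\<Sum>i\<in>UNIV. v $ i * (gauss z * partial i f (x + s *\<^sub>R z)))
      - (v \<bullet> z) * gauss z * f (x + s *\<^sub>R z)" for z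
  proof -
    have "gauss z * (v \<bullet> gradient f (x + s *\<^sub>R z)) = (\<Sum>i\<in>UNIV. v $ i * (gauss z * partial i f (x + s *\<^sub>R z)))"
      by (simp add: inner_vec_def sum_distrib_left gradient_def mult.left_commute)
    then show ?thesis by (simp add: F'_def mult.left_commute[of "gauss z" s])
  qed
  have "(LINT z|lborel. F' z v) = 0"
  proof (rule integral_directional_derivative_eq_0)
    show "(F has_derivative F' z) (at z)" for z
    proof -
      have "((\<lambda>z. f (x + s *\<^sub>R z)) has_derivative (\<lambda>h. (s *\<^sub>R h) \<bullet> gradient f (x + s *\<^sub>R z))) (at z)"
        by (rule has_derivative_compose[OF _ schwartz_has_derivative[OF f]]) (auto intro!: derivative_eq_intros)
      from has_derivative_mult[OF has_derivative_gauss this] show ?thesis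
        by (simp only: F_def[abs_def] F'_def[abs_def])
    qed
    have cont: "continuous_on UNIV (\<lambda>z. h (x + s *\<^sub>R z))" if "h \<in> schwartz" for h :: "real ^ 'n \<Rightarrow> real"
      by (rule continuous_on_compose2[OF schwartz_continuous_on[OF that, of UNIV]])
        (auto intro!: continuous_intros)
    show "continuous_on UNIV (\<lambda>z. F' z v)"
      unfolding F'_v by (intro continuous_intros cont schwartz_partial f)
    show "integrable lborel F"
      unfolding F_def[abs_def] by (rule integrable_gauss_mean[OF f])
    show "integrable lborel (\<lambda>z. F' z v)"
      unfolding F'_v using D R by simp
  qed
  also have "(LINT z|lborel. F' z v) = s * (\<Sum>i\<in>UNIV. v $ i * gauss_mean s (partial i f) x)
      - (LINT z|lborel. (v \<bullet> z) * gauss z * f (x + s *\<^sub>R z))"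
    unfolding F'_v using D R by (simp add: gauss_mean_def)
  finally have "s * (\<Sum>i\<in>UNIV. v $ i * gauss_mean s (partial i f) x)
      = (LINT z|lborel. (v \<bullet> z) * gauss z * f (x + s *\<^sub>R z))" by simp
  also have "\<dots> \<le> (LINT z|lborel. norm v * ?L * (norm (z :: real ^ 'n) * gauss z))"
    by (rule integral_mono[OF R int_bound]) (rule order.trans[OF abs_ge_self R_le[unfolded real_norm_def]])
  also have "\<dots> \<le> norm v * ?L * gauss_moment TYPE('n)"
    unfolding gauss_moment_def integral_mult_right_zero using L by (intro mult_left_mono) auto
  finally show ?thesis using s by (simp add: pos_le_divide_eq mult.commute)
qed

lemma gauss_moment_pos: "gauss_moment TYPE('n::finite) > 0"
proof -
  have "0 \<le> (LINT z|lborel. norm (z :: real ^ 'n) * gauss z)"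
    by (intro integral_nonneg_AE AE_I2) (simp add: gauss_nonneg)
  then show ?thesis by (simp add: gauss_moment_def)
qed

theorem theorem2p5:
  fixes \<alpha> :: real
  assumes "0 < \<alpha>" and "\<alpha> < 2"
  shows "\<exists>c>0. \<forall>f :: real ^ 'n::finite \<Rightarrow> real.
           f \<in> schwartz \<longrightarrow> (\<exists>z. f z \<noteq> 0) \<longrightarrow>
           (\<forall>x. gradient f x \<bullet> Lambda_vec \<alpha> (gradient f) x
                \<ge> 1 / 2 * Lambda \<alpha> (\<lambda>y. (norm (gradient f y))\<^sup>2) x
                   + norm (gradient f x) powr (2 + \<alpha>) / (c * Linf_norm f powr \<alpha>))"
proof -
  define K where "K = weight_const \<alpha>"
  define M where "M = gauss_moment TYPE('n)"
  define c where "c = 4 * \<alpha> * (4 * M) powr \<alpha> * K"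
  have K: "K > 0" unfolding K_def using assms by (rule weight_const_pos)
  have M: "M > 0" unfolding M_def by (rule gauss_moment_pos)
  have c: "c > 0" unfolding c_def using assms K M by simp
  have main: "gradient f x \<bullet> Lambda_vec \<alpha> (gradient f) x
      \<ge> 1 / 2 * Lambda \<alpha> (\<lambda>y. (norm (gradient f y))\<^sup>2) x
        + norm (gradient f x) powr (2 + \<alpha>) / (c * Linf_norm f powr \<alpha>)"
    if f: "f \<in> schwartz" and nz: "\<exists>z. f z \<noteq> 0" for f :: "real ^ 'n \<Rightarrow> real" and x
  proof -
    define v where "v = gradient f x"
    define L where "L = Linf_norm f"
    define D where "D = v \<bullet> Lambda_vec \<alpha> (gradient f) x - 1 / 2 * Lambda \<alpha> (\<lambda>y. (norm (gradient f y))\<^sup>2) x"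
    define P where "P s = (\<Sum>i\<in>UNIV. v $ i * gauss_mean s (partial i f) x)" for s
    define Q where "Q s = gauss_mean s (\<lambda>y. (norm (gradient f y))\<^sup>2) x" for s
    \<comment> \<open>the Gaussian mean of \<open>|\<nabla>f(x) - \<nabla>f(x + s z)|\<^sup>2\<close>\<close>
    define B where "B s = (norm v)\<^sup>2 - 2 * P s + Q s" for s
    have L: "L > 0"
    proof -
      obtain z where "f z \<noteq> 0" using nz by blast
      then show ?thesis using abs_le_Linf_norm[OF f, of z] by (simp add: L_def)
    qed
    have int: "has_bochner_integral lborel (\<lambda>s. weight \<alpha> s * (B s / 2)) (K * D)"
    proof -
      have "has_bochner_integral lborel
          (\<lambda>s. (\<Sum>i\<in>UNIV. v $ i * (weight \<alpha> s * (partial i f x - gauss_mean s (partial i f) x)))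
            - 1 / 2 * (weight \<alpha> s * ((norm (gradient f x))\<^sup>2 - gauss_mean s (\<lambda>y. (norm (gradient f y))\<^sup>2) x)))
          ((\<Sum>i\<in>UNIV. v $ i * (weight_const \<alpha> * Lambda \<alpha> (partial i f) x))
            - 1 / 2 * (weight_const \<alpha> * Lambda \<alpha> (\<lambda>y. (norm (gradient f y))\<^sup>2) x))"
        by (intro has_bochner_integral_diff has_bochner_integral_sum has_bochner_integral_mult_right
            has_bochner_integral_Lambda schwartz_partial schwartz_norm_gradient_squared f assms)
      also have "(\<lambda>s. (\<Sum>i\<in>UNIV. v $ i * (weight \<alpha> s * (partial i f x - gauss_mean s (partial i f) x)))
            - 1 / 2 * (weight \<alpha> s * ((norm (gradient f x))\<^sup>2 - gauss_mean s (\<lambda>y. (norm (gradient f y))\<^sup>2) x)))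
          = (\<lambda>s. weight \<alpha> s * (B s / 2))"
      proof
        fix s
        have "(\<Sum>i\<in>UNIV. v $ i * (weight \<alpha> s * (partial i f x - gauss_mean s (partial i f) x)))
            = weight \<alpha> s * ((\<Sum>i\<in>UNIV. v $ i * partial i f x) - P s)"
          unfolding P_def sum_distrib_left sum_subtractf[symmetric]
          by (intro sum.cong refl) (simp add: algebra_simps)
        also have "(\<Sum>i\<in>UNIV. v $ i * partial i f x) = (norm v)\<^sup>2"
          unfolding v_def norm_gradient_squared by (simp add: gradient_def power2_eq_square)
        finally show "(\<Sum>i\<in>UNIV. v $ i * (weight \<alpha> s * (partial i f x - gauss_mean s (partial i f) x)))
            - 1 / 2 * (weight \<alpha> s * ((norm (gradient f x))\<^sup>2 - gauss_mean s (\<lambda>y. (norm (gradient f y))\<^sup>2) x))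
          = weight \<alpha> s * (B s / 2)"
          by (simp add: B_def Q_def v_def field_simps)
      qed
      also have "(\<Sum>i\<in>UNIV. v $ i * (weight_const \<alpha> * Lambda \<alpha> (partial i f) x))
            - 1 / 2 * (weight_const \<alpha> * Lambda \<alpha> (\<lambda>y. (norm (gradient f y))\<^sup>2) x) = K * D"
        by (simp add: D_def K_def inner_vec_def Lambda_vec_def gradient_def sum_distrib_left right_diff_distrib mult_ac)
      finally show ?thesis .
    qed
    have B_nonneg: "B s \<ge> 0" for s
      using gauss_mean_square_nonneg[OF f, of x s] by (simp add: B_def P_def Q_def v_def)
    have Q_nonneg: "Q s \<ge> 0" for s
      unfolding Q_def gauss_mean_def by (intro integral_nonneg_AE AE_I2) (simp add: gauss_nonneg)
    have "norm v powr (2 + \<alpha>) / (c * L powr \<alpha>) \<le> D"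
    proof (cases "v = 0")
      case True
      have "0 \<le> (LINT s|lborel. weight \<alpha> s * (B s / 2))"
        by (intro integral_nonneg_AE AE_I2) (simp add: weight_nonneg B_nonneg)
      then have "0 \<le> K * D" unfolding has_bochner_integral_integral_eq[OF int] .
      with K True show ?thesis by (simp add: zero_le_mult_iff)
    next
      case False
      define n where "n = norm v"
      have n: "n > 0" using False by (simp add: n_def)
      \<comment> \<open>the scale from which on \<open>2 P s\<close> is at most half of \<open>n\<^sup>2\<close>\<close>
      define a where "a = 4 * M * L / n"
      have a: "a > 0" using M L n by (simp add: a_def)
      have B_ge: "n\<^sup>2 / 2 \<le> B s" if "a \<le> s" for s
      proof -
        have s: "s > 0" using that a by simp
        have "P s \<le> n * L * M / s"
          unfolding P_def n_def L_def M_def by (rule gauss_mean_directional_derivative_le[OF f s])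
        also have "\<dots> \<le> n * L * M / a"
          using that a s n L M by (intro divide_left_mono) auto
        also have "\<dots> = n\<^sup>2 / 4"
          using n L M by (simp add: a_def power2_eq_square)
        finally show ?thesis using Q_nonneg[of s] by (simp add: B_def n_def[symmetric])
      qed
      have I: "has_bochner_integral lborel (\<lambda>s. n\<^sup>2 / 4 * (indicator {a..} s * s powr (- 1 - \<alpha>)))
          (n\<^sup>2 / 4 * (- (a powr (- 1 - \<alpha> + 1)) / (- 1 - \<alpha> + 1)))"
        using assms a by (intro has_bochner_integral_mult_right has_bochner_integral_powr_atLeast) auto
      have "n\<^sup>2 / 4 * (- (a powr (- 1 - \<alpha> + 1)) / (- 1 - \<alpha> + 1))
          = (LINT s|lborel. n\<^sup>2 / 4 * (indicator {a..} s * s powr (- 1 - \<alpha>)))"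
        using I by (rule has_bochner_integral_integral_eq[symmetric])
      also have "\<dots> \<le> (LINT s|lborel. weight \<alpha> s * (B s / 2))"
      proof (rule integral_mono[OF integrable.intros[OF I] integrable.intros[OF int]])
        fix s :: real
        show "n\<^sup>2 / 4 * (indicator {a..} s * s powr (- 1 - \<alpha>)) \<le> weight \<alpha> s * (B s / 2)"
        proof (cases "a \<le> s")
          case True
          then have "s powr (- 1 - \<alpha>) * (n\<^sup>2 / 4) \<le> s powr (- 1 - \<alpha>) * (B s / 2)"
            using B_ge[OF True] by (intro mult_left_mono) auto
          with True a show ?thesis by (simp add: weight_def mult.commute)
        next
          case False
          then show ?thesis by (simp add: weight_nonneg B_nonneg)
        qed
      qed
      also have "\<dots> = K * D" using int by (rule has_bochner_integral_integral_eq)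
      finally have "n\<^sup>2 / (4 * \<alpha>) * a powr (- \<alpha>) \<le> K * D" by (simp add: field_simps)
      moreover have "n\<^sup>2 / (4 * \<alpha>) * a powr (- \<alpha>) = K * (n powr (2 + \<alpha>) / (c * L powr \<alpha>))"
      proof -
        have "a powr (- \<alpha>) = n powr \<alpha> / ((4 * M) powr \<alpha> * L powr \<alpha>)"
        proof -
          have "a powr \<alpha> = (4 * M) powr \<alpha> * L powr \<alpha> / n powr \<alpha>"
            using n M L by (simp add: a_def powr_divide powr_mult)
          then show ?thesis by (simp add: powr_minus)
        qed
        moreover have "n powr (2 + \<alpha>) = n\<^sup>2 * n powr \<alpha>"
          using n by (simp add: powr_add)
        ultimately show ?thesis
          using K by (simp add: c_def)
      qed
      ultimately have "K * (n powr (2 + \<alpha>) / (c * L powr \<alpha>)) \<le> K * D" by simp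
      then show ?thesis using K unfolding n_def by (rule mult_left_le_imp_le)
    qed
    then show ?thesis by (simp add: D_def v_def L_def)
  qed
  show ?thesis using c main by blast
qed

end
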